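(* Let $\mathsf{dist}$ be a generalized distance on $\mathcal P(\mathbb Z_+)$ satisfying the decomposition property. Let $p$ be a probability distribution on $\mathbb Z_+$ with finite support $\{y_1,\dots,y_m\}$ of size $m$. Then for every $h>0$ the constrained minimizer $\operatorname{argmin}_{Q\in\mathcal P([0,h])}\mathsf{dist}(p\,\|\,f_Q)$ exists, is unique, and is a discrete distribution with support size at most $m$. Furthermore, the unconstrained minimizer $\operatorname{argmin}_{Q\in\mathcal P(\mathbb R_+)}\mathsf{dist}(p\,\|\,f_Q)$ also exists, is unique, and is a discrete distribution with support size at most $m$; in addition it is supported on $[\min_{i=1,\dots,m}y_i,\ \max_{i=1,\dots,m}y_i]$.
   Context: $\mathbb Z_+=\{0,1,2,\dots\}$, $\mathbb R_+=[0,\infty)$. For a Borel set $\Theta\subset\mathbb R$, $\mathcal P(\Theta)$ is the set of Borel probability measures on $\Theta$; $\mathcal P(\mathbb Z_+)$ is the set of probability mass functions on $\mathbb Z_+$. For $Q\in\mathcal P(\mathbb R_+)$ the Poisson mixture is $f_Q(y)=\int f_\theta(y)\,Q(d\theta)$ with $f_\theta(y)=e^{-\theta}\theta^y/y!$, $y\in\mathbb Z_+$ (with $0^0=1$). A generalized distance is a map $\mathsf{dist}:\mathcal P(\mathbb Z_+)\times\mathcal P(\mathbb Z_+)\to[0,\infty]$ with $\mathsf{dist}(p\|q)\ge 0$ and equality if and only if $p=q$. Decomposition property: there exist maps $t:\mathcal P(\mathbb Z_+)\to\mathbb R$ and $\ell:[0,\infty)^2\to(-\infty,\infty]$, with $\ell(a,b)$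 finite for $b>0$, such that for all $q_1,q_2\in\mathcal P(\mathbb Z_+)$, $\mathsf{dist}(q_1\|q_2)=t(q_1)+\sum_{y\ge0}\ell(q_1(y),q_2(y))$, where $b\mapsto\ell(a,b)$ is strictly decreasing and strictly convex (and continuous on $[0,\infty)$ as an extended-real-valued function) for each $a>0$, and $\ell(0,b)=0$ for all $b\ge0$. *)

theory Defs
  imports "HOL-Probability.Probability"
begin

text \<open>A law on a Borel set \<open>\<Theta>\<close> is represented by its extension to the Borel sets of the line, so that
  the laws on \<open>[0,h]\<close> are literally among those on \<open>[0,\<infinity>)\<close>.\<close>

definition prob_measures_on :: "real set \<Rightarrow> real measure set" where
  "prob_measures_on \<Theta> = {Q. real_distribution Q \<and> measure Q \<Theta> = 1}"

text \<open>The library's \<open>poisson_pmf\<close> is specified for positive rates only, whereas the mixing law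
  may charge 0; here \<open>0 ^ 0 = 1\<close> gives the point mass at 0.\<close>

definition poisson_mass :: "real \<Rightarrow> nat \<Rightarrow> real" where
  "poisson_mass \<theta> y = exp (- \<theta>) * \<theta> ^ y / fact y"

definition poisson_mixture :: "real measure \<Rightarrow> nat pmf" where
  "poisson_mixture Q = embed_pmf (\<lambda>y. \<integral>\<theta>. poisson_mass \<theta> y \<partial>Q)"

lemma poisson_mass_nonneg: "0 \<le> \<theta> \<Longrightarrow> 0 \<le> poisson_mass \<theta> y"
  by (simp add: poisson_mass_def)

lemma poisson_mass_sums: "poisson_mass \<theta> sums 1"
proof -
  have "(\<lambda>y. exp (- \<theta>) * (\<theta> ^ y /\<^sub>R fact y)) sums (exp (- \<theta>) * exp \<theta>)"
    by (intro sums_mult exp_converges)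
  then show ?thesis
    by (simp add: poisson_mass_def[abs_def] field_simps flip: exp_add)
qed

lemma poisson_mass_le_1:
  assumes "0 \<le> \<theta>" shows "poisson_mass \<theta> y \<le> 1"
  using sum_le_suminf[OF sums_summable[OF poisson_mass_sums], of "{y}" \<theta>]
    sums_unique[OF poisson_mass_sums, of \<theta>] poisson_mass_nonneg[OF assms] by simp

lemma poisson_mass_measurable [measurable]: "(\<lambda>\<theta>. poisson_mass \<theta> y) \<in> borel_measurable borel"
  by (simp add: poisson_mass_def)

lemma prob_measures_on_AE:
  assumes "Q \<in> prob_measures_on \<Theta>"
  shows "AE \<theta> in Q. \<theta> \<in> \<Theta>"
proof -
  interpret real_distribution Q using assms by (simp add: prob_measures_on_def)
  show ?thesis using assms AE_prob_1 by (simp add: prob_measures_on_def)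
qed

lemma pmf_poisson_mixture:
  assumes Q: "Q \<in> prob_measures_on {0..}"
  shows "pmf (poisson_mixture Q) y = (\<integral>\<theta>. poisson_mass \<theta> y \<partial>Q)"
proof -
  interpret real_distribution Q using Q by (simp add: prob_measures_on_def)
  have ae: "AE \<theta> in Q. 0 \<le> \<theta>" using prob_measures_on_AE[OF Q] by simp
  have nonneg: "AE \<theta> in Q. 0 \<le> poisson_mass \<theta> k" for k
    using ae by eventually_elim (rule poisson_mass_nonneg)
  have int: "integrable Q (\<lambda>\<theta>. poisson_mass \<theta> k)" for k
  proof (rule integrable_const_bound[where B = 1])
    show "AE \<theta> in Q. norm (poisson_mass \<theta> k) \<le> 1"
      using ae by eventually_elim (simp add: poisson_mass_nonneg poisson_mass_le_1)
  qed simp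
  have "(\<integral>\<^sup>+ k. ennreal (\<integral>\<theta>. poisson_mass \<theta> k \<partial>Q) \<partial>count_space UNIV)
      = (\<Sum>k. \<integral>\<^sup>+ \<theta>. ennreal (poisson_mass \<theta> k) \<partial>Q)"
    using nn_integral_eq_integral[OF int nonneg] by (simp add: nn_integral_count_space_nat)
  also have "\<dots> = (\<integral>\<^sup>+ \<theta>. (\<Sum>k. ennreal (poisson_mass \<theta> k)) \<partial>Q)"
    by (rule nn_integral_suminf[symmetric]) simp
  also have "\<dots> = (\<integral>\<^sup>+ \<theta>. 1 \<partial>Q)"
  proof (rule nn_integral_cong_AE)
    show "AE \<theta> in Q. (\<Sum>k. ennreal (poisson_mass \<theta> k)) = 1"
      using ae by eventually_elim
        (simp add: suminf_ennreal2 poisson_mass_nonneg sums_summable[OF poisson_mass_sums]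
          sums_unique[OF poisson_mass_sums, symmetric])
  qed
  also have "\<dots> = 1" by (simp add: emeasure_space_1[unfolded space_eq_univ])
  finally show ?thesis
    unfolding poisson_mixture_def
    by (intro pmf_embed_pmf integral_nonneg_AE nonneg)
qed

definition generalized_distance :: "(nat pmf \<Rightarrow> nat pmf \<Rightarrow> ereal) \<Rightarrow> bool" where
  "generalized_distance D \<longleftrightarrow> (\<forall>q1 q2. 0 \<le> D q1 q2 \<and> (D q1 q2 = 0 \<longleftrightarrow> q1 = q2))"

definition strictly_convex_on :: "real set \<Rightarrow> (real \<Rightarrow> ereal) \<Rightarrow> bool" where
  "strictly_convex_on S f \<longleftrightarrow> convex S \<and>
    (\<forall>x\<in>S. \<forall>y\<in>S. \<forall>u. x \<noteq> y \<and> 0 < u \<and> u < 1 \<longrightarrow>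
      f (u * x + (1 - u) * y) < ereal u * f x + ereal (1 - u) * f y)"

definition admissible_loss :: "(real \<Rightarrow> real \<Rightarrow> ereal) \<Rightarrow> bool" where
  "admissible_loss L \<longleftrightarrow>
    (\<forall>a\<ge>0. \<forall>b\<ge>0. L a b \<noteq> -\<infinity>) \<and>
    (\<forall>a\<ge>0. \<forall>b>0. \<bar>L a b\<bar> \<noteq> \<infinity>) \<and>
    (\<forall>b\<ge>0. L 0 b = 0) \<and>
    (\<forall>a>0. strict_antimono_on {0..} (L a) \<and> strictly_convex_on {0..} (L a) \<and>
      continuous_on {0..} (L a))"

text \<open>The series is the limit of its partial sums in the extended reals; its existence is part of
  the property.\<close>

definition decomposition_property :: "(nat pmf \<Rightarrow> nat pmf \<Rightarrow> ereal) \<Rightarrow> bool" where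
  "decomposition_property D \<longleftrightarrow>
    (\<exists>(t :: nat pmf \<Rightarrow> real) L. admissible_loss L \<and>
      (\<forall>q1 q2. summable (\<lambda>y. L (pmf q1 y) (pmf q2 y)) \<and>
        D q1 q2 = ereal (t q1) + (\<Sum>y. L (pmf q1 y) (pmf q2 y))))"

definition is_mixing_minimizer ::
    "(nat pmf \<Rightarrow> nat pmf \<Rightarrow> ereal) \<Rightarrow> nat pmf \<Rightarrow> real set \<Rightarrow> real measure \<Rightarrow> bool" where
  "is_mixing_minimizer D p \<Theta> =
    is_arg_min (\<lambda>Q. D p (poisson_mixture Q)) (\<lambda>Q. Q \<in> prob_measures_on \<Theta>)"

definition discrete_distribution :: "real measure \<Rightarrow> bool" where
  "discrete_distribution Q \<longleftrightarrow> (\<exists>A. countable A \<and> measure Q A = 1)"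

definition measure_support :: "real measure \<Rightarrow> real set" where
  "measure_support Q = {x. \<forall>U. open U \<and> x \<in> U \<longrightarrow> measure Q U > 0}"

end

theory Submission
  imports Defs
begin

text \<open>Only the masses \<open>v = (f\<^sub>Q(y))\<close>, \<open>y \<in> Y = supp p\<close>, matter, and the objective is strictly convex and
  strictly decreasing in them. On \<open>[0,h]\<close> a minimizer exists by tightness, its \<open>v\<close> is unique by strict
  convexity, and monotonicity gives weights \<open>w \<ge> 0\<close> such that \<open>v\<close> maximizes \<open>u \<mapsto> \<Sum>y. w y * u y\<close> over mixtures. Hence
  every minimizer lives on the set \<open>Z\<close> where \<open>g(\<theta>) = \<Sum>y. w y * f\<^sub>\<theta>(y)\<close> attains its maximum \<open>M\<close>.
  The function \<open>exp \<theta> * (M - g(\<theta>))\<close> is a nonnegative power series with negative coefficients only at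
  \<open>y \<in> Y\<close>, so a Descartes-type count gives \<open>card Z \<le> card Y\<close>; and on at most \<open>card Y\<close> points the weights
  are determined by \<open>v\<close>, since an exponential sum with \<open>s\<close> terms has fewer than \<open>s\<close> zeros.
  On the half-line, clamping \<open>Q\<close> to \<open>[min Y, max Y]\<close> raises every mass, because \<open>\<theta> \<mapsto> f\<^sub>\<theta>(y)\<close>
  is unimodal with mode \<open>y\<close>.\<close>

subsection \<open>Zeros of exponential sums and power series\<close>

text \<open>One \<open>P\<close>-point is picked in each gap between consecutive points of
  \<open>Z\<close>. Disjointness from \<open>Z\<close> lets old and new points later be counted
  together.\<close>

lemma rolle_zeros_between:
  fixes Z :: "real set"
  assumes "finite Z"
    and "\<And>x y. \<lbrakk>x \<in> Z; y \<in> Z; x < y\<rbrakk> \<Longrightarrow> \<exists>z. x < z \<and> z < y \<and> P z"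
  shows "\<exists>W. finite W \<and> card W = card Z - 1 \<and> W \<inter> Z = {} \<and>
    (\<forall>w\<in>W. P w \<and> Min Z < w \<and> w < Max Z)"
  using assms
proof (induction Z rule: finite_linorder_max_induct)
  case empty
  show ?case by (intro exI[of _ "{}"]) simp
next
  case (insert b A)
  show ?case
  proof (cases "A = {}")
    case True
    then show ?thesis by (intro exI[of _ "{}"]) simp
  next
    case False
    have P: "\<exists>z. x < z \<and> z < y \<and> P z" if "x \<in> A" "y \<in> A" "x < y" for x y
      using insert.prems that by blast
    obtain W where W: "finite W" "card W = card A - 1" "W \<inter> A = {}"
      "\<And>w. w \<in> W \<Longrightarrow> P w \<and> Min A < w \<and> w < Max A"
      using insert.IH[OF P] by blast
    have A: "Max A \<in> A" "Min A \<in> A" "Max A < b" "Min A < b"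
      using False insert.hyps by auto
    \<comment> \<open>Points are inserted in increasing order, so the only new gap lies between
      \<open>Max A\<close> and \<open>b\<close>; the upper bound \<open>Max A\<close> on
      \<open>W\<close> makes \<open>z\<close> a new point.\<close>
    obtain z where z: "Max A < z" "z < b" "P z"
      using insert.prems[of "Max A" b] A by auto
    have le: "a \<le> Max A" if "a \<in> A" for a using that insert.hyps by simp
    have "z \<notin> W" "z \<notin> A" "b \<notin> W" "b \<notin> A" using W(4) z le A by fastforce+
    moreover have "Min (insert b A) = Min A" "Max (insert b A) = b"
      using False insert.hyps A by (simp_all add: min_absorb2 max_absorb1)
    moreover have "card A > 0" using False insert.hyps by auto
    moreover have "Min A < z" using le[OF A(2)] z by linarith
    ultimately show ?thesis
      using W z A insert.hyps by (intro exI[of _ "insert z W"]) fastforce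
  qed
qed

text \<open>Induction on the number of exponentials: dividing by one of them and differentiating
  removes one term and, by Rolle, costs at most one zero.\<close>

lemma exp_sum_eq_0_imp:
  fixes x d :: "'a \<Rightarrow> real" and Y :: "real set"
  assumes "finite J" "inj_on x J" "finite Y" "card J \<le> card Y"
    and "\<And>y. y \<in> Y \<Longrightarrow> (\<Sum>j\<in>J. d j * exp (x j * y)) = 0"
  shows "\<forall>j\<in>J. d j = 0"
  using assms
proof (induction J arbitrary: d Y rule: finite_induct)
  case empty
  then show ?case by simp
next
  case (insert a J)
  \<comment> \<open>After division by \<open>exp (x a * y)\<close> the term at \<open>a\<close> is
    constant, so it drops out of \<open>f'\<close>.\<close>
  define f where "f y = (\<Sum>j\<in>insert a J. d j * exp ((x j - x a) * y))" for y
  define f' where "f' y = (\<Sum>j\<in>insert a J. d j * ((x j - x a) * exp ((x j - x a) * y)))" for y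
  have der: "(f has_real_derivative f' y) (at y)" for y
  proof -
    have "((\<lambda>y. d j * exp ((x j - x a) * y)) has_real_derivative
        d j * ((x j - x a) * exp ((x j - x a) * y))) (at y)" for j
      by (auto intro!: derivative_eq_intros)
    then show ?thesis unfolding f_def[abs_def] f'_def by (intro DERIV_sum)
  qed
  have exp_shift: "exp (x a * y) * exp ((x j - x a) * y) = exp (x j * y)" for j y
    by (simp add: algebra_simps flip: exp_add)
  have "exp (x a * y) * f y = (\<Sum>j\<in>insert a J. d j * exp (x j * y))" for y
    unfolding f_def sum_distrib_left by (simp add: mult.left_commute exp_shift)
  then have f0: "f y = 0" if "y \<in> Y" for y
    using insert.prems(4)[OF that] by (metis exp_not_eq_zero mult_eq_0_iff)
  have "\<exists>z. u < z \<and> z < v \<and> f' z = 0" if "u \<in> Y" "v \<in> Y" "u < v" for u v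
  proof -
    have "\<exists>z. u < z \<and> z < v \<and> DERIV f z :> 0"
    proof (rule Rolle[OF that(3)])
      show "f u = f v" using f0 that by simp
      show "continuous_on {u..v} f"
        by (intro continuous_at_imp_continuous_on ballI DERIV_isCont[OF der])
      show "f differentiable (at x)" for x
        using der real_differentiable_def by blast
    qed
    then show ?thesis using DERIV_unique[OF der] by blast
  qed
  then obtain W where W: "finite W" "card W = card Y - 1" "\<forall>w\<in>W. f' w = 0"
    using rolle_zeros_between[OF insert.prems(2), of "\<lambda>z. f' z = 0"] by blast
  have "exp (x a * y) * f' y = (\<Sum>j\<in>J. d j * (x j - x a) * exp (x j * y))" for y
    unfolding f'_def sum_distrib_left using insert.hyps
    by (simp add: mult.left_commute exp_shift mult.assoc)
  \<comment> \<open>The induction hypothesis is applied to the coefficients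
    \<open>d j * (x j - x a)\<close> and the Rolle points \<open>W\<close>; injectivity of
    \<open>x\<close> then removes the second factor.\<close>
  then have "\<forall>j\<in>J. d j * (x j - x a) = 0"
    using W insert.prems insert.hyps by (intro insert.IH[of W]) (auto simp flip: \<open>\<And>y. exp (x a * y) * f' y = _\<close>)
  moreover have "x j \<noteq> x a" if "j \<in> J" for j
    using inj_onD[OF insert.prems(1), of j a] that insert.hyps by auto
  ultimately have J: "\<forall>j\<in>J. d j = 0" by auto
  obtain y where "y \<in> Y" using insert.prems insert.hyps by fastforce
  then have "d a = 0" using insert.prems(4)[of y] J insert.hyps by simp
  then show ?case using J by simp
qed

text \<open>The Euler operator \<open>x * F' - k * F\<close> multiplies the \<open>n\<close>-th
  coefficient by \<open>n - k\<close>. Up to the factor \<open>x ^ Suc k\<close> it is the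
  derivative of \<open>F / x ^ k\<close>, which makes Rolle applicable to it.\<close>

lemma power_series_euler:
  fixes c :: "nat \<Rightarrow> real"
  assumes "\<And>x. summable (\<lambda>n. c n * x ^ n)"
  shows "summable (\<lambda>n. (real n - real k) * c n * x ^ n)"
    and "0 < x \<Longrightarrow> ((\<lambda>x. (\<Sum>n. c n * x ^ n) / x ^ k) has_real_derivative
      (\<Sum>n. (real n - real k) * c n * x ^ n) / x ^ Suc k) (at x)"
proof -
  let ?F = "\<lambda>x. \<Sum>n. c n * x ^ n"
  let ?F' = "\<Sum>n. diffs c n * x ^ n"
  have sm: "summable (\<lambda>n. diffs c n * x ^ n)"
    using termdiff_converges_all[OF assms] by simp
  have "(\<lambda>n. x * (diffs c n * x ^ n)) sums (x * ?F')"
    using sm by (intro sums_mult summable_sums)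
  then have "(\<lambda>n. real (Suc n) * c (Suc n) * x ^ Suc n) sums (x * ?F')"
    by (simp add: diffs_def mult_ac)
  \<comment> \<open>The term at \<open>n = 0\<close> carries the factor \<open>real n = 0\<close>,
    so shifting the index back adds nothing.\<close>
  then have 1: "(\<lambda>n. real n * c n * x ^ n) sums (x * ?F')"
    by (subst (asm) sums_Suc_iff) simp
  have 2: "(\<lambda>n. real k * (c n * x ^ n)) sums (real k * ?F x)"
    by (intro sums_mult summable_sums assms)
  have 3: "(\<lambda>n. (real n - real k) * c n * x ^ n) sums (x * ?F' - real k * ?F x)"
    using sums_diff[OF 1 2] by (simp add: algebra_simps)
  show "summable (\<lambda>n. (real n - real k) * c n * x ^ n)" using 3 by (rule sums_summable)
  have eq: "(\<Sum>n. (real n - real k) * c n * x ^ n) = x * ?F' - real k * ?F x"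
    using 3 by (rule sums_unique[symmetric])
  show "((\<lambda>x. ?F x / x ^ k) has_real_derivative
      (\<Sum>n. (real n - real k) * c n * x ^ n) / x ^ Suc k) (at x)" if "0 < x"
    unfolding eq using that
    by (auto intro!: derivative_eq_intros termdiffs_strong_converges_everywhere assms
        simp: field_simps power_Suc[symmetric] simp del: power_Suc)
      (cases k; simp add: field_simps)
qed

text \<open>Rolle applied to \<open>F / x ^ k\<close> on the positive axis, where the division is
  harmless: the coefficient at \<open>k\<close> is deleted at the price of one zero.\<close>

lemma power_series_rolle:
  fixes c :: "nat \<Rightarrow> real"
  assumes sm: "\<And>x. summable (\<lambda>n. c n * x ^ n)"
    and Z: "finite Z" "Z \<subseteq> {0<..}" "\<And>z. z \<in> Z \<Longrightarrow> (\<Sum>n. c n * z ^ n) = 0"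
  shows "\<exists>W. finite W \<and> W \<subseteq> {0<..} \<and> card W = card Z - 1 \<and> W \<inter> Z = {} \<and>
    (\<forall>w\<in>W. (\<Sum>n. (real n - real k) * c n * w ^ n) = 0)"
proof -
  let ?f = "\<lambda>x. (\<Sum>n. c n * x ^ n) / x ^ k"
  let ?f' = "\<lambda>x. (\<Sum>n. (real n - real k) * c n * x ^ n) / x ^ Suc k"
  note der = power_series_euler(2)[OF sm, of _ k]
  have "\<exists>z. u < z \<and> z < v \<and> 0 < z \<and> ?f' z = 0" if "u \<in> Z" "v \<in> Z" "u < v" for u v
  proof -
    have pos: "0 < u" "0 < v" using Z(2) that by auto
    have "\<exists>z. u < z \<and> z < v \<and> DERIV ?f z :> 0"
    proof (rule Rolle[OF that(3)])
      show "?f u = ?f v" using Z(3) that by simp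
      show "continuous_on {u..v} ?f"
      proof (intro continuous_at_imp_continuous_on ballI)
        fix x assume "x \<in> {u..v}"
        then have "0 < x" using pos by simp
        then show "isCont ?f x" by (rule DERIV_isCont[OF der])
      qed
      show "\<And>x. u < x \<Longrightarrow> x < v \<Longrightarrow> ?f differentiable (at x)"
        using der pos real_differentiable_def less_trans by blast
    qed
    then obtain z where z: "u < z" "z < v" "DERIV ?f z :> 0" by blast
    then have "0 < z" using pos by simp
    then show ?thesis using DERIV_unique[OF der z(3)] z by blast
  qed
  then obtain W where "finite W" "card W = card Z - 1" "W \<inter> Z = {}" "\<forall>w\<in>W. 0 < w \<and> ?f' w = 0"
    using rolle_zeros_between[OF Z(1), of "\<lambda>z. 0 < z \<and> ?f' z = 0"] by blast
  then show ?thesis by (intro exI[of _ W]) auto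
qed

text \<open>Two Rolle steps multiply the \<open>n\<close>-th coefficient by \<open>(n - k)\<^sup>2\<close>: the negative coefficient at
  \<open>k\<close> disappears, no sign changes elsewhere, and at most two zeros are lost.\<close>

lemma card_zeros_le_neg_coeffs:
  fixes c :: "nat \<Rightarrow> real"
  assumes "finite N" "\<And>n. n \<notin> N \<Longrightarrow> 0 \<le> c n" "\<exists>n. n \<notin> N \<and> 0 < c n"
    and "\<And>x. summable (\<lambda>n. c n * x ^ n)"
    and "finite Z" "Z \<subseteq> {0<..}" "\<And>z. z \<in> Z \<Longrightarrow> (\<Sum>n. c n * z ^ n) = 0"
  shows "card Z \<le> 2 * card N"
  using assms
proof (induction N arbitrary: c Z rule: finite_induct)
  case empty
  have "Z = {}"
  proof (rule ccontr)
    assume "Z \<noteq> {}"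
    then obtain z where z: "z \<in> Z" by blast
    then have "0 < z" using empty.prems by auto
    obtain n where "0 < c n" using empty.prems by auto
    then have "0 < (\<Sum>n. c n * z ^ n)"
      using empty.prems \<open>0 < z\<close> by (intro suminf_pos2[where i = n]) auto
    then show False using empty.prems z by simp
  qed
  then show ?case by simp
next
  case (insert k N)
  obtain W where W: "finite W" "W \<subseteq> {0<..}" "card W = card Z - 1" "W \<inter> Z = {}"
    "\<And>w. w \<in> W \<Longrightarrow> (\<Sum>n. (real n - real k) * c n * w ^ n) = 0"
    using power_series_rolle[OF insert.prems(3-6), of k] by blast
  obtain V where V: "finite V" "V \<subseteq> {0<..}" "card V = card W - 1" "V \<inter> W = {}"
    "\<And>w. w \<in> V \<Longrightarrow> (\<Sum>n. (real n - real k) * ((real n - real k) * c n) * w ^ n) = 0"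
    using power_series_rolle[OF power_series_euler(1)[OF insert.prems(3)] W(1,2,5), of k] by blast
  have "card V \<le> 2 * card N"
  proof (rule insert.IH[OF _ _ _ V(1,2,5)])
    show "summable (\<lambda>n. (real n - real k) * ((real n - real k) * c n) * x ^ n)" for x
      by (intro power_series_euler(1) insert.prems)
    show "0 \<le> (real n - real k) * ((real n - real k) * c n)" if "n \<notin> N" for n
      using insert.prems(1)[of n] that
      by (cases "n = k") (auto simp flip: mult.assoc)
    \<comment> \<open>This index differs from \<open>k\<close>, so the factor
      \<open>(n - k)\<^sup>2\<close> keeps its coefficient positive.\<close>
    obtain n where "n \<notin> insert k N" "0 < c n" using insert.prems by blast
    then show "\<exists>n. n \<notin> N \<and> 0 < (real n - real k) * ((real n - real k) * c n)"
      by (intro exI[of _ n])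
        (simp del: mult.assoc add: mult.assoc[symmetric] power2_eq_square[symmetric])
  qed
  then show ?case using V(3) W(3) insert.hyps by simp
qed

text \<open>Interior zeros are zeros of the derivative as well, so together with the Rolle zeros
  between them the function counts almost every zero twice; one endpoint zero is affordable.\<close>

lemma card_touching_zeros_le_neg_coeffs:
  fixes c :: "nat \<Rightarrow> real"
  assumes N: "finite N" "\<And>n. n \<notin> N \<Longrightarrow> 0 \<le> c n" "\<exists>n. n \<notin> N \<and> 0 < c n"
    and sm: "\<And>x. summable (\<lambda>n. c n * x ^ n)"
    and nonneg: "\<And>x. \<lbrakk>0 < x; x \<le> h\<rbrakk> \<Longrightarrow> 0 \<le> (\<Sum>n. c n * x ^ n)"
    and Z: "finite Z" "Z \<subseteq> {0<..h}" "\<And>z. z \<in> Z \<Longrightarrow> (\<Sum>n. c n * z ^ n) = 0"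
  shows "card Z \<le> card N"
proof -
  have Z0: "Z \<subseteq> {0<..}" using Z by auto
  show ?thesis
  proof (cases "N = {}")
    case True
    then show ?thesis using card_zeros_le_neg_coeffs[OF N sm Z(1) Z0 Z(3)] by simp
  next
    case False
    then obtain k where k: "k \<in> N" by blast
    obtain W where W: "finite W" "W \<subseteq> {0<..}" "card W = card Z - 1" "W \<inter> Z = {}"
      "\<And>w. w \<in> W \<Longrightarrow> (\<Sum>n. (real n - real k) * c n * w ^ n) = 0"
      using power_series_rolle[OF sm Z(1) Z0 Z(3), of k] by blast
    \<comment> \<open>At \<open>h\<close> the sign is known only on the left, so a zero there need
      not be a critical point.\<close>
    define R where "R = Z - {h}"
    have R0: "(\<Sum>n. (real n - real k) * c n * z ^ n) = 0" if "z \<in> R" for z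
    proof -
      have z: "0 < z" "z < h" "z \<in> Z" using that Z by (auto simp: R_def)
      \<comment> \<open>A zero of a function that is nonnegative nearby is a local minimum; the
        radius \<open>min z (h - z)\<close> keeps the neighbourhood inside the interval from 0 to
        \<open>h\<close>.\<close>
      have "(\<Sum>n. (real n - real k) * c n * z ^ n) / z ^ Suc k = 0"
      proof (rule DERIV_local_min[OF power_series_euler(2)[OF sm z(1)]])
        show "0 < min z (h - z)" using z by simp
        show "\<forall>y. \<bar>z - y\<bar> < min z (h - z) \<longrightarrow>
            (\<Sum>n. c n * z ^ n) / z ^ k \<le> (\<Sum>n. c n * y ^ n) / y ^ k"
          using nonneg Z(3)[OF z(3)] by auto
      qed
      then show ?thesis using z by simp
    qed
    define U where "U = R \<union> W"
    have U: "finite U" "U \<subseteq> {0<..}" using W Z unfolding U_def R_def by auto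
    have U0: "(\<Sum>n. (real n - real k) * c n * z ^ n) = 0" if "z \<in> U" for z
      using that R0 W unfolding U_def by auto
    have "card R \<ge> card Z - 1" unfolding R_def by (simp add: Z(1) card_Diff_singleton_if)
    moreover have "card U = card R + card W" unfolding U_def
      using W Z by (intro card_Un_disjoint) (auto simp: R_def)
    ultimately have cU: "card U \<ge> 2 * (card Z - 1)" using W by simp
    obtain V where V: "finite V" "V \<subseteq> {0<..}" "card V = card U - 1" "V \<inter> U = {}"
      "\<And>w. w \<in> V \<Longrightarrow> (\<Sum>n. (real n - real k) * ((real n - real k) * c n) * w ^ n) = 0"
      using power_series_rolle[OF power_series_euler(1)[OF sm] U U0, of k] by blast
    have "card V \<le> 2 * card (N - {k})"
    proof (rule card_zeros_le_neg_coeffs[OF _ _ _ _ V(1,2,5)])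
      show "finite (N - {k})" using N by simp
      show "summable (\<lambda>n. (real n - real k) * ((real n - real k) * c n) * x ^ n)" for x
        by (intro power_series_euler(1) sm)
      show "0 \<le> (real n - real k) * ((real n - real k) * c n)" if "n \<notin> N - {k}" for n
        using N(2)[of n] that
        by (cases "n = k") (auto simp flip: mult.assoc)
      obtain n where "n \<notin> N" "0 < c n" using N by blast
      moreover from this have "n \<noteq> k" using k by blast
      ultimately show "\<exists>n. n \<notin> N - {k} \<and> 0 < (real n - real k) * ((real n - real k) * c n)"
        by (intro exI[of _ n])
          (simp del: mult.assoc add: mult.assoc[symmetric] power2_eq_square[symmetric])
    qed
    moreover have "card N \<ge> 1" using N(1) False by (simp add: Suc_leI card_gt_0_iff)
    \<comment> \<open>For \<open>card Z \<ge> 2\<close> the counts give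
      \<open>2 * card Z - 3 \<le> 2 * (card N - 1)\<close>, that is
      \<open>2 * card Z \<le> 2 * card N + 1\<close>, and parity yields the claim; smaller
      \<open>Z\<close> are covered by \<open>card N \<ge> 1\<close>.\<close>
    ultimately show ?thesis using V(3) cU k N(1) by (simp add: card_Diff_singleton)
  qed
qed

subsection \<open>Poisson masses\<close>

lemma poisson_mass_0: "poisson_mass 0 y = (if y = 0 then 1 else 0)"
  by (simp add: poisson_mass_def)

text \<open>The \<open>n\<close>-th coefficient of \<open>exp \<theta> * (M - g(\<theta>))\<close>
  is \<open>(M - w n) / fact n\<close> on \<open>Y\<close> and \<open>M / fact n\<close> elsewhere,
  so the count of touching zeros bounds the positive maximizers. The rate 0 is outside that count
  and is treated separately.\<close>

lemma poisson_combination_argmax: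
  fixes w :: "nat \<Rightarrow> real"
  assumes Y: "finite Y" and M: "0 < M"
    and le: "\<And>\<theta>. \<lbrakk>0 \<le> \<theta>; \<theta> \<le> h\<rbrakk> \<Longrightarrow> (\<Sum>y\<in>Y. w y * poisson_mass \<theta> y) \<le> M"
  defines "Z \<equiv> {\<theta>\<in>{0..h}. (\<Sum>y\<in>Y. w y * poisson_mass \<theta> y) = M}"
  shows "finite Z" "card Z \<le> card Y" "0 \<in> Z \<Longrightarrow> 0 \<in> Y"
proof -
  let ?g = "\<lambda>\<theta>. \<Sum>y\<in>Y. w y * poisson_mass \<theta> y"
  define c where "c n = (M - (if n \<in> Y then w n else 0)) / fact n" for n
  define N where "N = {y\<in>Y. M < w y}"
  have sums: "(\<lambda>n. c n * x ^ n) sums (exp x * (M - ?g x))" for x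
  proof -
    have 1: "(\<lambda>n. M * (x ^ n /\<^sub>R fact n)) sums (M * exp x)"
      by (intro sums_mult exp_converges)
    have 2: "(\<lambda>n. if n \<in> Y then w n * x ^ n / fact n else 0) sums (\<Sum>n\<in>Y. w n * x ^ n / fact n)"
      using Y by (rule sums_If_finite_set)
    have 3: "(\<Sum>n\<in>Y. w n * x ^ n / fact n) = exp x * ?g x"
      unfolding sum_distrib_left poisson_mass_def by (intro sum.cong) (simp_all add: exp_minus)
    have "c n * x ^ n = M * (x ^ n /\<^sub>R fact n) - (if n \<in> Y then w n * x ^ n / fact n else 0)" for n
      by (simp add: c_def field_simps)
    then have "(\<lambda>n. c n * x ^ n) sums (M * exp x - exp x * ?g x)"
      using sums_diff[OF 1 2] unfolding 3 by presburger
    then show ?thesis by (simp add: algebra_simps)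
  qed
  note sm = sums_summable[OF sums]
  note eq = sums_unique[OF sums, symmetric]
  have N: "finite N" using Y by (simp add: N_def)
  have nonneg: "0 \<le> c n" if "n \<notin> N" for n using that M by (auto simp: c_def N_def)
  obtain n where "n \<notin> Y" using Y ex_new_if_finite by blast
  then have pos: "\<exists>n. n \<notin> N \<and> 0 < c n" using M by (auto simp: c_def N_def intro!: exI[of _ n])
  \<comment> \<open>Finiteness of \<open>Z\<close> is not yet known; a uniform bound on its finite
    subsets gives finiteness and the cardinality at once.\<close>
  have "card G \<le> card N" if G: "G \<subseteq> Z - {0}" "finite G" for G
  proof (rule card_touching_zeros_le_neg_coeffs[OF N nonneg pos sm])
    show "0 \<le> (\<Sum>n. c n * x ^ n)" if "0 < x" "x \<le> h" for x
      using le[of x] that by (simp add: eq)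
    show "G \<subseteq> {0<..h}" using G by (auto simp: Z_def)
    show "(\<Sum>n. c n * z ^ n) = 0" if "z \<in> G" for z
      using that G by (auto simp: eq Z_def)
  qed (use G in auto)
  then have fin: "finite (Z - {0})" "card (Z - {0}) \<le> card N"
    using finite_if_finite_subsets_card_bdd by blast+
  then show "finite Z" by simp
  have g0: "?g 0 = (if 0 \<in> Y then w 0 else 0)"
    using Y by (simp add: poisson_mass_0 if_distrib[of "\<lambda>t. _ * t"] sum.delta' cong: if_cong)
  then show zero: "0 \<in> Z \<Longrightarrow> 0 \<in> Y" using M by (auto simp: Z_def split: if_splits)
  show "card Z \<le> card Y"
  proof (cases "0 \<in> Z")
    case True
    then have "?g 0 = M" by (simp add: Z_def)
    \<comment> \<open>If 0 is a maximizer, the coefficient at index 0 vanishes, so 0 is not in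
      \<open>N\<close>; the index thus saved pays for the extra point.\<close>
    then have "w 0 = M" unfolding g0 using zero[OF True] by simp
    then have "N \<subseteq> Y - {0}" by (auto simp: N_def)
    then have "card N \<le> card (Y - {0})" using Y by (intro card_mono) auto
    moreover have "card Y \<ge> 1" using zero[OF True] Y by (auto simp: Suc_le_eq card_gt_0_iff)
    ultimately show ?thesis using fin True zero[OF True] Y by simp
  next
    case False
    have "card N \<le> card Y" using Y by (intro card_mono) (auto simp: N_def)
    then show ?thesis using fin False by simp
  qed
qed

text \<open>For positive rates \<open>z ^ y = exp (ln z * y)\<close>, so the columns are exponential
  sums with distinct exponents \<open>ln z\<close>. The rate 0, which has no such form, is split
  off.\<close>

lemma poisson_mass_linear_independent:
  fixes d :: "real \<Rightarrow> real"
  assumes Y: "finite Y" and Z: "finite Z" "Z \<subseteq> {0..}" "card Z \<le> card Y" "0 \<in> Z \<Longrightarrow> 0 \<in> Y"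
    and eq: "\<And>y. y \<in> Y \<Longrightarrow> (\<Sum>z\<in>Z. d z * poisson_mass z y) = 0"
  shows "\<forall>z\<in>Z. d z = 0"
proof -
  \<comment> \<open>The rate 0 contributes only at index 0; dropping both preserves the comparison
    of cardinalities, and index 0 later determines \<open>d 0\<close>.\<close>
  define Y' where "Y' = (if 0 \<in> Z then Y - {0} else Y)"
  have pos: "\<forall>z\<in>Z - {0}. d z * exp (- z) = 0"
  proof (rule exp_sum_eq_0_imp[where x = ln and Y = "real ` Y'"])
    show "inj_on ln (Z - {0})" using Z(2) by (intro inj_onI) (simp add: less_le subset_iff)
    have "card Y' = card (real ` Y')" by (simp add: card_image)
    then show "card (Z - {0}) \<le> card (real ` Y')" using Z Y by (auto simp: Y'_def)
    fix r assume "r \<in> real ` Y'"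
    then obtain y where y: "y \<in> Y'" "r = real y" by blast
    have "(\<Sum>z\<in>Z - {0}. d z * poisson_mass z y) = (\<Sum>z\<in>Z. d z * poisson_mass z y)"
      using y Z by (intro sum.mono_neutral_left) (auto simp: poisson_mass_0 Y'_def)
    also have "\<dots> = 0" using y eq by (auto simp: Y'_def split: if_splits)
    finally have 0: "(\<Sum>z\<in>Z - {0}. d z * poisson_mass z y) = 0" .
    have "(\<Sum>z\<in>Z - {0}. d z * exp (- z) * exp (ln z * r))
        = fact y * (\<Sum>z\<in>Z - {0}. d z * poisson_mass z y)"
      unfolding sum_distrib_left
    proof (intro sum.cong refl)
      fix z assume "z \<in> Z - {0}"
      then have "0 < z" using Z(2) by force
      then have "exp (ln z * r) = z ^ y"
        by (simp add: y(2) exp_of_nat2_mult)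
      then show "d z * exp (- z) * exp (ln z * r) = fact y * (d z * poisson_mass z y)"
        by (simp add: poisson_mass_def)
    qed
    then show "(\<Sum>z\<in>Z - {0}. d z * exp (- z) * exp (ln z * r)) = 0" using 0 by simp
  qed (use Z Y in \<open>auto simp: Y'_def\<close>)
  have "d 0 = 0" if "0 \<in> Z"
  proof -
    have "(\<Sum>z\<in>Z. d z * poisson_mass z 0) = (\<Sum>z\<in>Z. if z = 0 then d 0 else 0)"
      using pos by (intro sum.cong) (auto simp: poisson_mass_0)
    then show ?thesis using eq[OF Z(4)[OF that]] that Z by simp
  qed
  then show ?thesis using pos by auto
qed

text \<open>The factor \<open>real y / x - 1\<close> shows the sign, hence the mode at
  \<open>y\<close>.\<close>

lemma DERIV_poisson_mass:
  assumes "0 < x"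
  shows "((\<lambda>\<theta>. poisson_mass \<theta> y) has_real_derivative poisson_mass x y * (real y / x - 1)) (at x)"
proof -
  have "real y * x ^ (y - 1) = x ^ y * real y / x" using assms by (cases y) auto
  then show ?thesis unfolding poisson_mass_def
    by (auto intro!: derivative_eq_intros simp: field_simps)
qed

lemma continuous_on_poisson_mass: "continuous_on S (\<lambda>\<theta>. poisson_mass \<theta> y)"
  unfolding poisson_mass_def by (intro continuous_intros) auto

lemma poisson_mass_pos: "0 < \<theta> \<Longrightarrow> 0 < poisson_mass \<theta> y"
  by (simp add: poisson_mass_def)

lemma poisson_mass_strict_increasing:
  assumes "0 \<le> s" "s < t" "t \<le> real y"
  shows "poisson_mass s y < poisson_mass t y"
proof (rule DERIV_pos_imp_increasing_open[OF assms(2)])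
  show "\<exists>d. ((\<lambda>\<theta>. poisson_mass \<theta> y) has_real_derivative d) (at x) \<and> 0 < d"
    if "s < x" "x < t" for x
    using that assms DERIV_poisson_mass[of x y]
    by (intro exI[of _ "poisson_mass x y * (real y / x - 1)"])
      (auto intro!: mult_pos_pos poisson_mass_pos)
qed (rule continuous_on_poisson_mass)

lemma poisson_mass_strict_decreasing:
  assumes "real y \<le> s" "s < t"
  shows "poisson_mass t y < poisson_mass s y"
proof (rule DERIV_neg_imp_decreasing_open[OF assms(2)])
  show "\<exists>d. ((\<lambda>\<theta>. poisson_mass \<theta> y) has_real_derivative d) (at x) \<and> d < 0"
    if "s < x" "x < t" for x
  proof -
    have "0 < x" using that assms by linarith
    then show ?thesis
      using that assms DERIV_poisson_mass[of x y]
      by (intro exI[of _ "poisson_mass x y * (real y / x - 1)"])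
        (auto intro!: mult_pos_neg poisson_mass_pos)
  qed
qed (rule continuous_on_poisson_mass)

subsection \<open>Separating weights\<close>

text \<open>Separation of a convex set from the open positive orthant. The dimension \<open>card I\<close> is not fixed
  by a type, so instead of a hyperplane theorem the proof adds one coordinate \<open>j\<close> at a time: the weights
  found for \<open>I\<close> on \<open>{v \<in> K. 0 < v j}\<close> reduce the step to the plane.\<close>

lemma separating_weights:
  fixes K :: "('i \<Rightarrow> real) set"
  assumes "finite I" "I \<noteq> {}"
    and "\<And>u v t. \<lbrakk>u \<in> K; v \<in> K; 0 \<le> t; t \<le> 1\<rbrakk> \<Longrightarrow> (\<lambda>i. t * u i + (1 - t) * v i) \<in> K"
    and "\<And>v. v \<in> K \<Longrightarrow> \<exists>i\<in>I. v i \<le> 0"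
  shows "\<exists>w. (\<forall>i\<in>I. 0 \<le> w i) \<and> (\<exists>i\<in>I. 0 < w i) \<and> (\<forall>v\<in>K. (\<Sum>i\<in>I. w i * v i) \<le> 0)"
  using assms
proof (induction I arbitrary: K rule: finite_ne_induct)
  case (singleton j)
  then show ?case by (intro exI[of _ "\<lambda>_. 1"]) auto
next
  case (insert j I)
  note conv = insert.prems(1)
  have "\<exists>w. (\<forall>i\<in>I. 0 \<le> w i) \<and> (\<exists>i\<in>I. 0 < w i) \<and> (\<forall>v\<in>{v\<in>K. 0 < v j}. (\<Sum>i\<in>I. w i * v i) \<le> 0)"
  proof (rule insert.IH)
    fix u v :: "'i \<Rightarrow> real" and t :: real
    assume *: "u \<in> {v\<in>K. 0 < v j}" "v \<in> {v\<in>K. 0 < v j}" "0 \<le> t" "t \<le> 1"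
    have "0 < t * u j + (1 - t) * v j"
      using * by (cases "t = 0") (auto intro!: add_pos_nonneg)
    then show "(\<lambda>i. t * u i + (1 - t) * v i) \<in> {v\<in>K. 0 < v j}" using conv * by simp
  next
    fix v assume "v \<in> {v\<in>K. 0 < v j}"
    then show "\<exists>i\<in>I. v i \<le> 0" using insert.prems(2)[of v] by auto
  qed
  then obtain w where w: "\<forall>i\<in>I. 0 \<le> w i" "\<exists>i\<in>I. 0 < w i"
    and neg: "\<And>v. \<lbrakk>v \<in> K; 0 < v j\<rbrakk> \<Longrightarrow> (\<Sum>i\<in>I. w i * v i) \<le> 0" by blast
  define s where "s v = (\<Sum>i\<in>I. w i * v i)" for v
  have s_comb: "s (\<lambda>i. t * u i + (1 - t) * v i) = t * s u + (1 - t) * s v" for t u v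
    by (simp add: s_def sum_distrib_left flip: sum.distrib) (simp add: algebra_simps)
  have sum_upd: "(\<Sum>i\<in>insert j I. (w(j := r)) i * v i) = r * v j + s v" for r v
  proof -
    have "(\<Sum>i\<in>I. (w(j := r)) i * v i) = s v"
      unfolding s_def using insert.hyps by (intro sum.cong) auto
    then show ?thesis using insert.hyps by (subst sum.insert) simp_all
  qed
  \<comment> \<open>It suffices to find one weight \<open>r\<close> for the coordinate
    \<open>j\<close>, keeping the weights \<open>w\<close> on \<open>I\<close>.\<close>
  have goal: ?case if "0 \<le> r" "\<And>v. v \<in> K \<Longrightarrow> r * v j + s v \<le> 0" for r
    using that w insert.hyps by (intro exI[of _ "w(j := r)"]) (auto simp only: sum_upd, auto)
  show ?case
  proof (cases "\<exists>u\<in>K. 0 < s u")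
    case False
    then show ?thesis by (intro goal[of 0]) (auto simp: not_less)
  next
    case True
    then obtain u0 where u0: "u0 \<in> K" "0 < s u0" by blast
    show ?thesis
    proof (cases "\<exists>v\<in>K. 0 < v j")
      case False
      \<comment> \<open>Here \<open>v j \<le> 0\<close> throughout \<open>K\<close>, so the weight
        concentrated on \<open>j\<close> separates.\<close>
      have "(\<Sum>i\<in>insert j I. (if i = j then 1 else 0) * v i) = v j" for v :: "'i \<Rightarrow> real"
        using insert.hyps by (simp add: if_distrib[of "\<lambda>t. t * _"] cong: if_cong)
      then show ?thesis using False
        by (intro exI[of _ "\<lambda>i. if i = j then 1 else 0"]) (auto simp: not_less)
    next
      case True
      then obtain v0 where v0: "v0 \<in> K" "0 < v0 j" by blast
      \<comment> \<open>In the plane with coordinates \<open>v j\<close> and \<open>s v\<close>: if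
        this failed, the segment joining the two points would meet the open positive quadrant,
        against \<open>neg\<close>.\<close>
      have cross: "v j * s u \<le> s v * u j" if uv: "u \<in> K" "0 < s u" "v \<in> K" "0 < v j" for u v
      proof (rule ccontr)
        assume "\<not> ?thesis"
        then have less: "s v * u j < v j * s u" by simp
        have sv: "s v \<le> 0" using neg[OF uv(3,4)] by (simp add: s_def)
        have uj: "u j \<le> 0" using neg[OF uv(1)] uv(2) by (force simp: s_def)
        \<comment> \<open>with these weights both \<open>j\<close> and \<open>s\<close> take the value \<open>v j * s u - s v * u j\<close>, up to scaling\<close>
        define p q where "p = s u - u j" and "q = v j - s v"
        have pq: "0 < p" "0 < q" using sv uj uv by (auto simp: p_def q_def)
        define t where "t = p / (p + q)"
        have t: "0 \<le> t" "t \<le> 1" "1 - t = q / (p + q)" using pq by (auto simp: t_def field_simps)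
        let ?z = "\<lambda>i. t * v i + (1 - t) * u i"
        have "?z j = (p * v j + q * u j) / (p + q)" unfolding t(3) by (simp add: t_def add_divide_distrib)
        moreover have "p * v j + q * u j = v j * s u - s v * u j" by (simp add: p_def q_def algebra_simps)
        ultimately have "0 < ?z j" using less pq by simp
        have "s ?z = t * s v + (1 - t) * s u" by (rule s_comb)
        also have "\<dots> = (p * s v + q * s u) / (p + q)"
          unfolding t(3) by (simp add: t_def add_divide_distrib)
        finally have "s ?z = (p * s v + q * s u) / (p + q)" .
        moreover have "p * s v + q * s u = v j * s u - s v * u j" by (simp add: p_def q_def algebra_simps)
        ultimately have "0 < s ?z" using less pq by simp
        moreover have "?z \<in> K" using conv uv t by blast
        ultimately show False using neg[of ?z] \<open>0 < ?z j\<close> by (simp add: s_def)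
      qed
      have uneg: "u j < 0" if "u \<in> K" "0 < s u" for u
      proof -
        have "0 < v0 j * s u" using v0 that by simp
        also have "\<dots> \<le> s v0 * u j" by (rule cross[OF that v0])
        finally show ?thesis using neg[OF v0] by (auto simp: s_def zero_less_mult_iff)
      qed
      \<comment> \<open>Each \<open>u\<close> with \<open>0 < s u\<close> demands that
        \<open>r\<close> be at least its element of \<open>R\<close>; each \<open>v\<close> with
        \<open>0 < v j\<close> demands \<open>r \<le> - s v / v j\<close>. By \<open>cross\<close>
        every lower bound is below every upper bound, so \<open>Sup R\<close> serves as
        \<open>r\<close>.\<close>
      define R where "R = {s u / (- u j) |u. u \<in> K \<and> 0 < s u}"
      have ub: "x \<le> - s v / v j" if "x \<in> R" "v \<in> K" "0 < v j" for x v
      proof -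
        obtain u where u: "u \<in> K" "0 < s u" "x = s u / (- u j)" using \<open>x \<in> R\<close> by (auto simp: R_def)
        show ?thesis unfolding u(3) using cross[OF u(1,2) that(2,3)] uneg[OF u(1,2)] that
          by (simp add: field_simps)
      qed
      have bdd: "bdd_above R" using ub v0 by (intro bdd_aboveI) blast
      have u0R: "s u0 / (- u0 j) \<in> R" using u0 by (auto simp: R_def)
      show ?thesis
      proof (rule goal[of "Sup R"])
        have "0 \<le> s u0 / (- u0 j)" using u0 uneg[of u0] by (simp add: field_simps)
        also have "\<dots> \<le> Sup R" by (rule cSup_upper[OF u0R bdd])
        finally show r0: "0 \<le> Sup R" .
        fix v assume v: "v \<in> K"
        consider "0 < v j" | "0 < s v" | "v j \<le> 0" "s v \<le> 0" by linarith
        then show "Sup R * v j + s v \<le> 0"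
        proof cases
          case 1
          have "Sup R \<le> - s v / v j" using u0R ub[OF _ v 1] by (intro cSup_least) auto
          then show ?thesis using 1 by (simp add: field_simps)
        next
          case 2
          have "s v / (- v j) \<le> Sup R" using v 2 by (intro cSup_upper bdd) (auto simp: R_def)
          then show ?thesis using uneg[OF v 2] by (simp add: field_simps)
        next
          case 3
          then show ?thesis using r0 by (simp add: add_nonpos_nonpos mult_nonneg_nonpos)
        qed
      qed
    qed
  qed
qed

subsection \<open>Mixing laws\<close>

text \<open>Extending the Poisson mass constantly to negative rates makes it bounded and continuous on
  the line, so that it can serve as a test function for weak convergence.\<close>

definition clipped_mass :: "nat \<Rightarrow> real \<Rightarrow> real" where
  "clipped_mass y \<theta> = poisson_mass (max 0 \<theta>) y"

lemma clipped_mass_bounds: "0 \<le> clipped_mass y \<theta>" "clipped_mass y \<theta> \<le> 1"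
  by (simp_all add: clipped_mass_def poisson_mass_nonneg poisson_mass_le_1)

lemma isCont_clipped_mass: "isCont (clipped_mass y) \<theta>"
  unfolding clipped_mass_def[abs_def] poisson_mass_def by (intro continuous_intros) auto

lemma clipped_mass_measurable [measurable]: "clipped_mass y \<in> borel_measurable borel"
  unfolding clipped_mass_def[abs_def] by measurable

lemma prob_measures_onD:
  assumes "Q \<in> prob_measures_on \<Theta>"
  shows "real_distribution Q" "measure Q \<Theta> = 1" "prob_space Q" "sets Q = sets borel" "space Q = UNIV"
proof -
  show 1: "real_distribution Q" "measure Q \<Theta> = 1"
    using assms by (simp_all add: prob_measures_on_def)
  interpret real_distribution Q by (rule 1)
  show "prob_space Q" "sets Q = sets borel" "space Q = UNIV"
    by (simp_all add: prob_space_axioms)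
qed

lemma prob_measures_onI:
  assumes "prob_space Q" "sets Q = sets borel" "AE \<theta> in Q. \<theta> \<in> \<Theta>" "\<Theta> \<in> sets borel"
  shows "Q \<in> prob_measures_on \<Theta>"
proof -
  interpret prob_space Q by (rule assms)
  have "real_distribution Q"
    using assms by (simp add: real_distribution_def real_distribution_axioms_def)
  moreover have "measure Q \<Theta> = 1"
    using assms by (subst prob_eq_1) auto
  ultimately show ?thesis by (simp add: prob_measures_on_def)
qed

lemma prob_measures_on_mono:
  assumes "Q \<in> prob_measures_on A" "A \<subseteq> B" "B \<in> sets borel"
  shows "Q \<in> prob_measures_on B"
  using prob_measures_onD[OF assms(1)] prob_measures_on_AE[OF assms(1)] assms
  by (intro prob_measures_onI) auto

lemma integrable_bounded:
  fixes f :: "real \<Rightarrow> real"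
  assumes "Q \<in> prob_measures_on \<Theta>" "f \<in> borel_measurable borel" "\<And>x. \<bar>f x\<bar> \<le> B"
  shows "integrable Q f"
proof -
  interpret real_distribution Q using prob_measures_onD[OF assms(1)] by simp
  show ?thesis using assms by (intro integrable_const_bound[of _ B]) auto
qed

lemma pmf_poisson_mixture_clipped:
  assumes Q: "Q \<in> prob_measures_on \<Theta>" "\<Theta> \<subseteq> {0..}"
  shows "pmf (poisson_mixture Q) y = (\<integral>\<theta>. clipped_mass y \<theta> \<partial>Q)"
proof -
  have Q0: "Q \<in> prob_measures_on {0..}" using Q by (rule prob_measures_on_mono) simp
  interpret real_distribution Q using prob_measures_onD[OF Q0] by simp
  show ?thesis unfolding pmf_poisson_mixture[OF Q0]
  proof (rule integral_cong_AE)
    show "AE \<theta> in Q. poisson_mass \<theta> y = clipped_mass y \<theta>"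
      using prob_measures_on_AE[OF Q0] by eventually_elim (simp add: clipped_mass_def)
  qed auto
qed

lemma integrable_clipped_mass:
  "Q \<in> prob_measures_on \<Theta> \<Longrightarrow> integrable Q (clipped_mass y)"
  by (rule integrable_bounded[where B = 1]) (auto simp: abs_le_iff clipped_mass_bounds
    intro: order_trans[OF _ clipped_mass_bounds(1)])

lemma return_in_prob_measures_on:
  assumes "\<theta> \<in> \<Theta>" "\<Theta> \<in> sets borel"
  shows "return borel \<theta> \<in> prob_measures_on \<Theta>"
  using assms by (intro prob_measures_onI prob_space_return) (auto simp: AE_return)

text \<open>The mixture is drawn by first tossing a coin with success probability \<open>t\<close>.
  Test functions with values in the unit interval cover both the clipped masses and the indicator of
  \<open>\<Theta>\<close>.\<close>

lemma convex_combination_measure: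
  fixes t :: real
  assumes Q: "Q1 \<in> prob_measures_on \<Theta>" "Q2 \<in> prob_measures_on \<Theta>" and \<Theta>: "\<Theta> \<in> sets borel"
    and t: "0 \<le> t" "t \<le> 1"
  obtains Q where "Q \<in> prob_measures_on \<Theta>"
    "\<And>f. \<lbrakk>f \<in> borel_measurable borel; \<And>x. 0 \<le> f x; \<And>x. f x \<le> 1\<rbrakk> \<Longrightarrow>
      (\<integral>x. f x \<partial>Q) = t * (\<integral>x. f x \<partial>Q1) + (1 - t) * (\<integral>x. f x \<partial>Q2)"
proof -
  note D1 = prob_measures_onD[OF Q(1)] and D2 = prob_measures_onD[OF Q(2)]
  define B where "B b = (if b then Q1 else Q2)" for b
  define Q where "Q = measure_pmf (bernoulli_pmf t) \<bind> B"
  have B: "B \<in> measure_pmf (bernoulli_pmf t) \<rightarrow>\<^sub>M prob_algebra borel"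
    using D1 D2 by (auto simp: B_def space_prob_algebra)
  have bern: "measure_pmf (bernoulli_pmf t) \<in> space (prob_algebra (count_space UNIV))"
    by (simp add: space_prob_algebra prob_space_measure_pmf)
  have B': "B \<in> count_space UNIV \<rightarrow>\<^sub>M prob_algebra borel"
    using B by (simp cong: measurable_cong_sets)
  have P: "prob_space Q" "sets Q = sets borel"
    using prob_space_bind'[OF bern B'] sets_bind'[OF bern B'] by (simp_all add: Q_def)
  have nn: "(\<integral>\<^sup>+x. f x \<partial>Q) = (\<integral>\<^sup>+x. f x \<partial>Q1) * t + (\<integral>\<^sup>+x. f x \<partial>Q2) * (1 - t)"
    if "f \<in> borel_measurable borel" for f
    unfolding Q_def
    by (subst nn_integral_bind[OF that measurable_prob_algebraD[OF B]])
      (use t in \<open>simp add: B_def\<close>)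
  have eq: "(\<integral>x. f x \<partial>Q) = t * (\<integral>x. f x \<partial>Q1) + (1 - t) * (\<integral>x. f x \<partial>Q2)"
    if f: "f \<in> borel_measurable borel" "\<And>x. 0 \<le> f x" "\<And>x. f x \<le> 1" for f
  proof -
    have int: "integrable M f" "(\<integral>\<^sup>+x. f x \<partial>M) = ennreal (\<integral>x. f x \<partial>M)" "0 \<le> (\<integral>x. f x \<partial>M)"
      if "prob_space M" "sets M = sets borel" for M
    proof -
      interpret prob_space M by (rule that)
      show 1: "integrable M f"
        using that f by (intro integrable_const_bound[of _ 1]) (auto cong: measurable_cong_sets)
      show "(\<integral>\<^sup>+x. f x \<partial>M) = ennreal (\<integral>x. f x \<partial>M)"
        using f by (intro nn_integral_eq_integral 1) auto
      show "0 \<le> (\<integral>x. f x \<partial>M)" using f by simp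
    qed
    have "ennreal (\<integral>x. f x \<partial>Q) = ennreal (t * (\<integral>x. f x \<partial>Q1) + (1 - t) * (\<integral>x. f x \<partial>Q2))"
      using nn[of "\<lambda>x. ennreal (f x)"] f int[OF P] int[OF D1(3,4)] int[OF D2(3,4)] t
      by (simp add: ennreal_mult'[symmetric] ennreal_plus[symmetric] mult.commute del: ennreal_plus)
    then show ?thesis
      using int(3)[OF P] int(3)[OF D1(3,4)] int(3)[OF D2(3,4)] t by (subst (asm) ennreal_inj) auto
  qed
  have "measure Q \<Theta> = 1"
    using eq[of "indicator \<Theta>"] \<Theta> P(2) D1 D2 by (simp add: indicator_le_1)
  then have "Q \<in> prob_measures_on \<Theta>"
    using P by (simp add: prob_measures_on_def real_distribution_def real_distribution_axioms_def)
  then show thesis using eq that by blast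
qed

text \<open>Sequential compactness in the weak topology: laws on a fixed bounded interval are tight,
  and the clipped masses are bounded continuous test functions.\<close>

lemma prob_measures_on_interval_compact:
  assumes Q: "\<And>n :: nat. Q n \<in> prob_measures_on {0..h}" and h: "0 \<le> h"
  obtains r R where "strict_mono r" "R \<in> prob_measures_on {0..h}"
    "\<And>y. (\<lambda>n. \<integral>\<theta>. clipped_mass y \<theta> \<partial>Q (r n)) \<longlonglongrightarrow> (\<integral>\<theta>. clipped_mass y \<theta> \<partial>R)"
proof -
  note D = prob_measures_onD[OF Q]
  have "tight Q" unfolding tight_def
  proof (intro conjI allI impI)
    show "real_distribution (Q n)" for n by (rule D)
    fix \<epsilon> :: real assume "0 < \<epsilon>"
    \<comment> \<open>Tightness uses intervals open on the left, so the left end is moved to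
      \<open>-1\<close> to retain an atom at 0.\<close>
    have "1 - \<epsilon> < measure (Q n) {-1<..h}" for n
    proof -
      interpret real_distribution "Q n" by (rule D)
      have "measure (Q n) {0..h} \<le> measure (Q n) {-1<..h}"
        by (intro finite_measure_mono) auto
      then show ?thesis using D(2)[of n] \<open>0 < \<epsilon>\<close> by simp
    qed
    then show "\<exists>a b. a < b \<and> (\<forall>n. 1 - \<epsilon> < measure (Q n) {a<..b})"
      using h by (intro exI[of _ "-1"] exI[of _ h]) auto
  qed
  then obtain r R where r: "strict_mono r" "real_distribution R" "weak_conv_m (Q \<circ> id \<circ> r) R"
    using tight_imp_convergent_subsubsequence[of Q id] by (auto simp: strict_mono_def)
  interpret R: real_distribution R by (rule r)
  have conv: "(\<lambda>n. \<integral>x. f x \<partial>Q (r n)) \<longlonglongrightarrow> (\<integral>x. f x \<partial>R)"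
    if "\<And>x. isCont f x" "\<And>x. norm (f x) \<le> 1" for f :: "real \<Rightarrow> real"
    using weak_conv_imp_integral_bdd_continuous_conv[of "Q \<circ> r" R f 1] that r D
    by (simp add: o_def)
  \<comment> \<open>The truncated distance to \<open>{0..h}\<close>: continuous, bounded and zero
    exactly on the interval. Its vanishing integral passes to the limit and confines
    \<open>R\<close> to the interval.\<close>
  define f where "f x = min 1 (max 0 (- x) + max 0 (x - h))" for x :: real
  have f: "isCont f x" "norm (f x) \<le> 1" "0 \<le> f x" for x
    unfolding f_def[abs_def] by (intro continuous_intros) (auto simp: f_def)
  have [measurable]: "f \<in> borel_measurable borel"
    unfolding f_def[abs_def] by measurable
  have "(\<integral>x. f x \<partial>Q (r n)) = 0" for n
  proof -
    have "AE x in Q (r n). f x = 0"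
      using prob_measures_on_AE[OF Q[of "r n"]] by eventually_elim (auto simp: f_def)
    then show ?thesis by (rule integral_eq_zero_AE)
  qed
  then have "(\<integral>x. f x \<partial>R) = 0"
    using conv[OF f(1,2)] by (simp add: LIMSEQ_const_iff)
  moreover have "integrable R f" using f by (intro R.integrable_const_bound[of _ 1]) auto
  ultimately have "AE x in R. f x = 0"
    using f by (subst (asm) integral_nonneg_eq_0_iff_AE) auto
  then have "AE x in R. x \<in> {0..h}"
    by eventually_elim (auto simp: f_def min_def max_def split: if_splits)
  then have "R \<in> prob_measures_on {0..h}"
    using R.prob_space_axioms by (intro prob_measures_onI) auto
  moreover have "(\<lambda>n. \<integral>\<theta>. clipped_mass y \<theta> \<partial>Q (r n)) \<longlonglongrightarrow> (\<integral>\<theta>. clipped_mass y \<theta> \<partial>R)" for y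
    using conv[of "clipped_mass y"] isCont_clipped_mass clipped_mass_bounds by simp
  ultimately show thesis using r that by blast
qed

text \<open>\<open>Q'\<close> is the image of \<open>Q\<close> under projection to the nearest point
  of \<open>{a..b}\<close>. For a mode \<open>y\<close> in that interval the projection moves every
  outside rate towards the mode and strictly raises its mass.\<close>

lemma clamp_measure:
  assumes Q: "Q \<in> prob_measures_on {0..}" and ab: "0 \<le> a" "a \<le> b"
  obtains Q' where "Q' \<in> prob_measures_on {a..b}"
    "\<And>y. \<lbrakk>a \<le> real y; real y \<le> b\<rbrakk> \<Longrightarrow>
      (\<integral>\<theta>. clipped_mass y \<theta> \<partial>Q) \<le> (\<integral>\<theta>. clipped_mass y \<theta> \<partial>Q')"
    "\<And>y. \<lbrakk>a \<le> real y; real y \<le> b; Q \<notin> prob_measures_on {a..b}\<rbrakk> \<Longrightarrow>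
      (\<integral>\<theta>. clipped_mass y \<theta> \<partial>Q) < (\<integral>\<theta>. clipped_mass y \<theta> \<partial>Q')"
proof -
  interpret real_distribution Q using prob_measures_onD[OF Q] by simp
  note ae = prob_measures_on_AE[OF Q]
  define k where "k \<theta> = max a (min b \<theta>)" for \<theta> :: real
  have [measurable]: "k \<in> borel_measurable borel" unfolding k_def[abs_def] by measurable
  define Q' where "Q' = distr Q borel k"
  have int': "(\<integral>\<theta>. clipped_mass y \<theta> \<partial>Q') = (\<integral>\<theta>. clipped_mass y (k \<theta>) \<partial>Q)" for y
    unfolding Q'_def by (intro integral_distr) auto
  have mem: "Q' \<in> prob_measures_on {a..b}"
    unfolding Q'_def
    by (intro prob_measures_onI prob_space_distr) (use ab in \<open>auto simp: AE_distr_iff k_def\<close>)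
  have int: "integrable Q (clipped_mass y)" "integrable Q (\<lambda>\<theta>. clipped_mass y (k \<theta>))" for y
    by (rule integrable_bounded[OF Q, of _ 1], measurable,
      auto simp: abs_le_iff clipped_mass_bounds intro: order_trans[OF _ clipped_mass_bounds(1)])+
  have less: "clipped_mass y \<theta> < clipped_mass y (k \<theta>)"
    if y: "a \<le> real y" "real y \<le> b" and \<theta>: "0 \<le> \<theta>" "\<theta> \<notin> {a..b}" for y \<theta>
  proof (cases "\<theta> < a")
    case True
    then have "k \<theta> = a" using ab by (simp add: k_def)
    then show ?thesis using poisson_mass_strict_increasing[OF \<theta>(1) True y(1)] \<theta> ab
      by (simp add: clipped_mass_def)
  next
    case False
    then have "b < \<theta>" "k \<theta> = b" using \<theta> ab by (auto simp: k_def)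
    then show ?thesis using poisson_mass_strict_decreasing[OF y(2), of \<theta>] \<theta> ab
      by (simp add: clipped_mass_def)
  qed
  have k_id: "k \<theta> = \<theta>" if "\<theta> \<in> {a..b}" for \<theta> using that by (auto simp: k_def)
  have le: "clipped_mass y \<theta> \<le> clipped_mass y (k \<theta>)"
    if "a \<le> real y" "real y \<le> b" "0 \<le> \<theta>" for y \<theta>
    using less[OF that] k_id[of \<theta>] by (cases "\<theta> \<in> {a..b}") auto
  show thesis
  proof (rule that[OF mem])
    fix y assume y: "a \<le> real y" "real y \<le> b"
    show "(\<integral>\<theta>. clipped_mass y \<theta> \<partial>Q) \<le> (\<integral>\<theta>. clipped_mass y \<theta> \<partial>Q')"
      unfolding int' using ae le[OF y] by (intro integral_mono_AE int) auto
    assume notin: "Q \<notin> prob_measures_on {a..b}"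
    show "(\<integral>\<theta>. clipped_mass y \<theta> \<partial>Q) < (\<integral>\<theta>. clipped_mass y \<theta> \<partial>Q')"
      unfolding int'
    proof (rule integral_less_AE[OF int, where A = "- {a..b}"])
      show "emeasure Q (- {a..b}) \<noteq> 0"
      proof
        assume "emeasure Q (- {a..b}) = 0"
        then have "AE \<theta> in Q. \<theta> \<in> {a..b}" by (intro AE_I[of _ _ "- {a..b}"]) auto
        then show False using notin prob_space_axioms by (auto intro!: prob_measures_onI)
      qed
      show "AE \<theta> in Q. \<theta> \<in> - {a..b} \<longrightarrow> clipped_mass y \<theta> \<noteq> clipped_mass y (k \<theta>)"
        using ae by eventually_elim (use less[OF y] in fastforce)
      show "AE \<theta> in Q. clipped_mass y \<theta> \<le> clipped_mass y (k \<theta>)"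
        using ae by eventually_elim (use le[OF y] in auto)
    qed auto
  qed
qed

section \<open>Finitely supported laws and supports\<close>

lemma integral_eq_sum_atoms:
  fixes f :: "real \<Rightarrow> real"
  assumes Q: "Q \<in> prob_measures_on Z" and Z: "finite Z" and f: "f \<in> borel_measurable borel"
  shows "(\<integral>x. f x \<partial>Q) = (\<Sum>z\<in>Z. f z * measure Q {z})"
proof -
  interpret real_distribution Q using prob_measures_onD[OF Q] by simp
  have "(\<integral>x. f x \<partial>Q) = (\<integral>x. (\<Sum>z\<in>Z. f z * indicator {z} x) \<partial>Q)"
  proof (rule integral_cong_AE)
    show "AE x in Q. f x = (\<Sum>z\<in>Z. f z * indicator {z} x)"
      using prob_measures_on_AE[OF Q]
      by eventually_elim (simp add: indicator_def if_distrib[of "\<lambda>t. _ * t"] Z cong: if_cong)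
  qed (use f in auto)
  also have "\<dots> = (\<Sum>z\<in>Z. f z * measure Q {z})"
  proof -
    have "integrable Q (indicator {z} :: real \<Rightarrow> real)" for z
      by (rule integrable_bounded[OF Q, of _ 1]) (auto simp: indicator_def)
    then show ?thesis by (subst Bochner_Integration.integral_sum) auto
  qed
  finally show ?thesis .
qed

lemma atomic_measures_eqI:
  assumes Q: "Q1 \<in> prob_measures_on Z" "Q2 \<in> prob_measures_on Z" and Z: "finite Z"
    and eq: "\<And>z. z \<in> Z \<Longrightarrow> measure Q1 {z} = measure Q2 {z}"
  shows "Q1 = Q2"
proof (rule measure_eqI)
  note D1 = prob_measures_onD[OF Q(1)] and D2 = prob_measures_onD[OF Q(2)]
  show "sets Q1 = sets Q2" using D1 D2 by simp
  interpret Q1: real_distribution Q1 by (rule D1)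
  interpret Q2: real_distribution Q2 by (rule D2)
  fix A assume "A \<in> sets Q1"
  then have A: "A \<in> sets borel" using D1 by simp
  have "measure Q1 A = (\<integral>x. indicator A x \<partial>Q1)"
    by (simp add: D1)
  also have "(\<integral>x. indicator A x \<partial>Q1) = (\<integral>x. indicator A x \<partial>Q2 :: real)"
    using A eq by (subst (1 2) integral_eq_sum_atoms[OF _ Z]) (auto simp: Q)
  also have "\<dots> = measure Q2 A" by (simp add: D2)
  finally show "emeasure Q1 A = emeasure Q2 A"
    by (simp add: Q1.emeasure_eq_measure Q2.emeasure_eq_measure)
qed

lemma measure_support_subset:
  assumes Q: "Q \<in> prob_measures_on Z" and Z: "closed Z"
  shows "measure_support Q \<subseteq> Z"
proof
  interpret real_distribution Q using prob_measures_onD[OF Q] by simp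
  fix x assume x: "x \<in> measure_support Q"
  show "x \<in> Z"
  proof (rule ccontr)
    assume "x \<notin> Z"
    then have "0 < measure Q (- Z)" using x Z by (auto simp: measure_support_def)
    moreover have "measure Q (- Z) = 1 - measure Q Z"
      using prob_compl[of Z] Z by (simp add: Compl_eq_Diff_UNIV)
    ultimately show False using prob_measures_onD(2)[OF Q] by simp
  qed
qed

subsection \<open>Minimizers of a decomposed loss\<close>

lemma sum_ereal_finite:
  assumes "\<And>y. y \<in> Y \<Longrightarrow> \<bar>f y\<bar> \<noteq> \<infinity>"
  shows "(\<Sum>y\<in>Y. f y) = ereal (\<Sum>y\<in>Y. real_of_ereal (f y))"
proof -
  have "(\<Sum>y\<in>Y. f y) = (\<Sum>y\<in>Y. ereal (real_of_ereal (f y)))"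
    using assms by (intro sum.cong) (auto simp: ereal_real)
  then show ?thesis by simp
qed

lemma tendsto_sum_ereal:
  fixes f :: "'a \<Rightarrow> 'b \<Rightarrow> ereal"
  assumes "finite Y" "\<And>y. y \<in> Y \<Longrightarrow> (f y \<longlongrightarrow> l y) F" "\<And>y. y \<in> Y \<Longrightarrow> l y \<noteq> -\<infinity>"
  shows "((\<lambda>x. \<Sum>y\<in>Y. f y x) \<longlongrightarrow> (\<Sum>y\<in>Y. l y)) F"
proof -
  \<comment> \<open>The induction also carries that the limit is not \<open>-\<infinity>\<close>, so
    that no sum of opposite infinities arises.\<close>
  have "((\<lambda>x. \<Sum>y\<in>Y. f y x) \<longlongrightarrow> (\<Sum>y\<in>Y. l y)) F \<and> (\<Sum>y\<in>Y. l y) \<noteq> -\<infinity>"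
    using assms
    by (induction Y rule: finite_induct) (auto intro!: tendsto_add_ereal_general)
  then show ?thesis by blast
qed

locale decomposed_risk =
  fixes L :: "real \<Rightarrow> real \<Rightarrow> ereal" and p :: "nat pmf"
  assumes loss: "admissible_loss L" and finite_support: "finite (set_pmf p)"
begin

abbreviation "Y \<equiv> set_pmf p"

text \<open>For laws on \<open>{0..}\<close> this is the mixture probability at \<open>y\<close>,
  written with a test function suited to weak limits.\<close>

definition mass :: "real measure \<Rightarrow> nat \<Rightarrow> real" where
  "mass Q y = (\<integral>\<theta>. clipped_mass y \<theta> \<partial>Q)"

text \<open>The distance from \<open>p\<close> to the mixture up to the constant \<open>t p\<close>:
  the condition \<open>L 0 b = 0\<close> removes all terms off the support.\<close>

definition risk :: "real measure \<Rightarrow> ereal" where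
  "risk Q = (\<Sum>y\<in>Y. L (pmf p y) (mass Q y))"

definition minimizer :: "real set \<Rightarrow> real measure \<Rightarrow> bool" where
  "minimizer \<Theta> Q \<longleftrightarrow> Q \<in> prob_measures_on \<Theta> \<and> (\<forall>R\<in>prob_measures_on \<Theta>. risk Q \<le> risk R)"

lemma pmf_pos: "y \<in> Y \<Longrightarrow> 0 < pmf p y"
  by (simp add: pmf_positive)

lemma mass_nonneg: "0 \<le> mass Q y"
  unfolding mass_def by (intro integral_nonneg_AE) (simp add: clipped_mass_bounds)

lemma loss_not_MInf: "0 \<le> b \<Longrightarrow> L (pmf p y) b \<noteq> -\<infinity>"
  using loss by (auto simp: admissible_loss_def)

lemma loss_finite: "0 < b \<Longrightarrow> \<bar>L (pmf p y) b\<bar> \<noteq> \<infinity>"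
  using loss by (simp add: admissible_loss_def)

lemma loss_less: "\<lbrakk>y \<in> Y; 0 \<le> b; b < c\<rbrakk> \<Longrightarrow> L (pmf p y) c < L (pmf p y) b"
proof -
  assume b: "y \<in> Y" "0 \<le> b" "b < c"
  have "strict_antimono_on {0..} (L (pmf p y))"
    using loss pmf_pos[OF b(1)] by (simp add: admissible_loss_def)
  from monotone_onD[OF this, of b c] b show ?thesis by simp
qed

lemma risk_finite: "(\<And>y. y \<in> Y \<Longrightarrow> 0 < mass Q y) \<Longrightarrow> \<bar>risk Q\<bar> \<noteq> \<infinity>"
  unfolding risk_def by (subst sum_ereal_finite) (auto simp: loss_finite)

lemma risk_finite_imp: "risk Q \<noteq> \<infinity> \<Longrightarrow> y \<in> Y \<Longrightarrow> \<bar>L (pmf p y) (mass Q y)\<bar> \<noteq> \<infinity>"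
  using sum_Pinfty[of "\<lambda>y. L (pmf p y) (mass Q y)" Y] finite_support
    loss_not_MInf[OF mass_nonneg[of Q y], of y]
  by (cases "L (pmf p y) (mass Q y)") (auto simp: risk_def)

lemma risk_antimono:
  assumes "\<And>y. y \<in> Y \<Longrightarrow> mass Q y \<le> mass R y"
  shows "risk R \<le> risk Q"
  unfolding risk_def
proof (rule sum_mono)
  fix y assume y: "y \<in> Y"
  show "L (pmf p y) (mass R y) \<le> L (pmf p y) (mass Q y)"
    using loss_less[OF y mass_nonneg[of Q y], of "mass R y"] assms[OF y]
    by (cases "mass Q y = mass R y") auto
qed

lemma risk_less:
  assumes "\<And>y. y \<in> Y \<Longrightarrow> mass Q y < mass R y"
  shows "risk R < risk Q"
proof -
  \<comment> \<open>Larger than a nonnegative number, every mass of \<open>R\<close> is positive;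
    hence the risk of \<open>R\<close> is finite even when that of \<open>Q\<close> is not.\<close>
  have pos: "0 < mass R y" if "y \<in> Y" for y
    using assms[OF that] mass_nonneg[of Q y] by linarith
  show ?thesis
  proof (cases "risk Q = \<infinity>")
    case True
    then show ?thesis using risk_finite[OF pos] by (cases "risk R") auto
  next
    case False
    note finQ = risk_finite_imp[OF False]
    have "real_of_ereal (L (pmf p y) (mass R y)) < real_of_ereal (L (pmf p y) (mass Q y))"
      if "y \<in> Y" for y
      using loss_less[OF that mass_nonneg assms[OF that]] finQ[OF that] loss_finite[OF pos[OF that], of y]
      by (cases "L (pmf p y) (mass R y)"; cases "L (pmf p y) (mass Q y)") auto
    then have "(\<Sum>y\<in>Y. real_of_ereal (L (pmf p y) (mass R y)))
        < (\<Sum>y\<in>Y. real_of_ereal (L (pmf p y) (mass Q y)))"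
      using finite_support set_pmf_not_empty by (intro sum_strict_mono) auto
    then show ?thesis unfolding risk_def using finQ loss_finite[OF pos]
      by (subst (1 2) sum_ereal_finite) auto
  qed
qed

text \<open>Strict convexity in a single coordinate where the masses differ already makes the sum
  strict; the other coordinates contribute weak inequalities.\<close>

lemma risk_midpoint_less:
  assumes fin: "risk Q1 \<noteq> \<infinity>" "risk Q2 \<noteq> \<infinity>"
    and ne: "y0 \<in> Y" "mass Q1 y0 \<noteq> mass Q2 y0"
    and R: "\<And>y. y \<in> Y \<Longrightarrow> mass R y = 1/2 * mass Q1 y + (1 - 1/2) * mass Q2 y"
  shows "risk R < max (risk Q1) (risk Q2)"
proof -
  define l1 l2 l where "l1 y = real_of_ereal (L (pmf p y) (mass Q1 y))"
    and "l2 y = real_of_ereal (L (pmf p y) (mass Q2 y))"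
    and "l y = real_of_ereal (L (pmf p y) (mass R y))" for y
  note f1 = risk_finite_imp[OF fin(1)] and f2 = risk_finite_imp[OF fin(2)]
  have L1: "L (pmf p y) (mass Q1 y) = ereal (l1 y)" "L (pmf p y) (mass Q2 y) = ereal (l2 y)"
    if "y \<in> Y" for y using f1[OF that] f2[OF that] by (simp_all add: l1_def l2_def ereal_real)
  have conv: "L (pmf p y) (mass R y) < ereal (1/2 * l1 y + (1 - 1/2) * l2 y)"
    if "y \<in> Y" "mass Q1 y \<noteq> mass Q2 y" for y
  proof -
    have "strictly_convex_on {0..} (L (pmf p y))"
      using loss pmf_pos[OF that(1)] by (simp add: admissible_loss_def)
    from this[unfolded strictly_convex_on_def, THEN conjunct2, rule_format,
      of "mass Q1 y" "mass Q2 y" "1/2"]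
    have "L (pmf p y) (1/2 * mass Q1 y + (1 - 1/2) * mass Q2 y)
      < ereal (1/2) * L (pmf p y) (mass Q1 y) + ereal (1 - 1/2) * L (pmf p y) (mass Q2 y)"
      using that mass_nonneg[of Q1 y] mass_nonneg[of Q2 y] by simp
    then show ?thesis using R[OF that(1)] L1[OF that(1)] by simp
  qed
  \<comment> \<open>The loss at the midpoint is either one of the finite given values or bounded
    above by strict convexity.\<close>
  have fin': "\<bar>L (pmf p y) (mass R y)\<bar> \<noteq> \<infinity>" if y: "y \<in> Y" for y
  proof (cases "mass Q1 y = mass Q2 y")
    case True
    then have "mass R y = mass Q1 y" using R[OF y] by simp
    then show ?thesis using f1[OF y] by simp
  next
    case False
    then show ?thesis using conv[OF y] loss_not_MInf[OF mass_nonneg[of R y], of y] by auto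
  qed
  have L': "L (pmf p y) (mass R y) = ereal (l y)" if "y \<in> Y" for y
    using fin'[OF that] by (simp add: l_def ereal_real)
  have less: "l y < 1/2 * l1 y + 1/2 * l2 y" if "y \<in> Y" "mass Q1 y \<noteq> mass Q2 y" for y
    using conv[OF that] L'[OF that(1)] by simp
  have le: "l y \<le> 1/2 * l1 y + 1/2 * l2 y" if "y \<in> Y" for y
  proof (cases "mass Q1 y = mass Q2 y")
    case True
    then have "l1 y = l2 y" "l y = l1 y" using R[OF that] by (simp_all add: l_def l1_def l2_def)
    then show ?thesis by simp
  qed (use less[OF that] in simp)
  have "(\<Sum>y\<in>Y. l y) < (\<Sum>y\<in>Y. 1/2 * l1 y + 1/2 * l2 y)"
    using less[OF ne] le ne(1) finite_support by (intro sum_strict_mono_ex1) auto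
  also have "\<dots> = 1/2 * (\<Sum>y\<in>Y. l1 y) + 1/2 * (\<Sum>y\<in>Y. l2 y)"
    by (simp add: sum.distrib sum_divide_distrib)
  finally have "(\<Sum>y\<in>Y. l y) < max (\<Sum>y\<in>Y. l1 y) (\<Sum>y\<in>Y. l2 y)" by simp
  moreover have "risk Q1 = ereal (\<Sum>y\<in>Y. l1 y)" "risk Q2 = ereal (\<Sum>y\<in>Y. l2 y)"
    "risk R = ereal (\<Sum>y\<in>Y. l y)"
    using L1 L' by (simp_all add: risk_def)
  ultimately show ?thesis by (simp add: max_def split: if_splits)
qed

section \<open>Minimizers on a bounded interval\<close>

lemma mass_return: "0 \<le> \<theta> \<Longrightarrow> mass (return borel \<theta>) y = poisson_mass \<theta> y"
  unfolding mass_def by (subst integral_return) (auto simp: clipped_mass_def)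

lemma convex_combination_mass:
  assumes "Q1 \<in> prob_measures_on \<Theta>" "Q2 \<in> prob_measures_on \<Theta>" "\<Theta> \<in> sets borel" "0 \<le> t" "t \<le> 1"
  obtains Q where "Q \<in> prob_measures_on \<Theta>" "\<And>y. mass Q y = t * mass Q1 y + (1 - t) * mass Q2 y"
proof (rule convex_combination_measure[OF assms])
  fix Q assume Q: "Q \<in> prob_measures_on \<Theta>"
    "\<And>f. \<lbrakk>f \<in> borel_measurable borel; \<And>x. 0 \<le> f x; \<And>x. f x \<le> 1\<rbrakk> \<Longrightarrow>
      (\<integral>x. f x \<partial>Q) = t * (\<integral>x. f x \<partial>Q1) + (1 - t) * (\<integral>x. f x \<partial>Q2)"
  show thesis
    by (rule that[OF Q(1)]) (simp add: mass_def Q(2) clipped_mass_bounds)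
qed

text \<open>Direct method: a minimizing sequence has a weak limit point, and the risk is continuous
  along the subsequence.\<close>

lemma minimizer_exists:
  assumes h: "0 < h"
  shows "\<exists>Q. minimizer {0..h} Q"
proof -
  let ?P = "prob_measures_on {0..h}"
  have "return borel h \<in> ?P" using h by (intro return_in_prob_measures_on) auto
  then obtain u where u: "\<And>n :: nat. u n \<in> risk ` ?P" "u \<longlonglongrightarrow> Inf (risk ` ?P)"
    using Inf_as_limit[of "risk ` ?P"] by blast
  then have "\<forall>n. \<exists>Q. Q \<in> ?P \<and> u n = risk Q" by blast
  then obtain Q where Q: "\<And>n. Q n \<in> ?P" "\<And>n. u n = risk (Q n)" by metis
  obtain r R where r: "strict_mono r" and R: "R \<in> ?P"
    and conv: "\<And>y. (\<lambda>n. mass (Q (r n)) y) \<longlonglongrightarrow> mass R y"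
    by (rule prob_measures_on_interval_compact[OF Q(1) less_imp_le[OF h], folded mass_def]) (rule that)
  have "(\<lambda>n. risk (Q (r n))) \<longlonglongrightarrow> risk R"
    unfolding risk_def
  proof (rule tendsto_sum_ereal[OF finite_support])
    fix y assume "y \<in> Y"
    \<comment> \<open>Continuity includes the endpoint 0, where the loss may be infinite; this
      covers limits with vanishing masses.\<close>
    then have "continuous_on {0..} (L (pmf p y))"
      using loss pmf_pos by (simp add: admissible_loss_def)
    then show "(\<lambda>n. L (pmf p y) (mass (Q (r n)) y)) \<longlonglongrightarrow> L (pmf p y) (mass R y)"
      by (rule continuous_on_tendsto_compose[OF _ conv]) (simp_all add: mass_nonneg)
    show "L (pmf p y) (mass R y) \<noteq> -\<infinity>" by (rule loss_not_MInf[OF mass_nonneg])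
  qed
  moreover have "(\<lambda>n. risk (Q (r n))) \<longlonglongrightarrow> Inf (risk ` ?P)"
    using LIMSEQ_subseq_LIMSEQ[OF u(2) r] Q(2) by (simp add: o_def)
  ultimately have "risk R = Inf (risk ` ?P)" by (rule LIMSEQ_unique)
  then have "risk R \<le> risk S" if "S \<in> ?P" for S using INF_lower[OF that, of risk] by simp
  then show ?thesis using R by (auto simp: minimizer_def)
qed

text \<open>The point mass at \<open>h > 0\<close> gives every count positive probability and serves
  as a competitor of finite risk.\<close>

lemma minimizer_risk_finite:
  assumes h: "0 < h" and Q: "minimizer {0..h} Q"
  shows "risk Q \<noteq> \<infinity>"
proof -
  have "\<bar>risk (return borel h)\<bar> \<noteq> \<infinity>"
    using h by (intro risk_finite) (simp add: mass_return poisson_mass_pos)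
  moreover have "risk Q \<le> risk (return borel h)"
    using Q h return_in_prob_measures_on[of h "{0..h}"] by (simp add: minimizer_def)
  ultimately show ?thesis by auto
qed

text \<open>Otherwise the equal mixture of both laws would have smaller risk. This identifies only
  the masses on \<open>Y\<close>, not yet the laws.\<close>

lemma minimizers_mass_eq:
  assumes h: "0 < h" and Q: "minimizer {0..h} Q1" "minimizer {0..h} Q2" and y: "y \<in> Y"
  shows "mass Q1 y = mass Q2 y"
proof (rule ccontr)
  assume ne: "mass Q1 y \<noteq> mass Q2 y"
  have P: "Q1 \<in> prob_measures_on {0..h}" "Q2 \<in> prob_measures_on {0..h}"
    using Q by (simp_all add: minimizer_def)
  obtain R where R: "R \<in> prob_measures_on {0..h}"
    "\<And>y. mass R y = 1/2 * mass Q1 y + (1 - 1/2) * mass Q2 y"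
    by (rule convex_combination_mass[OF P, of "1/2"]) (simp, simp, simp, rule that)
  have "risk R < max (risk Q1) (risk Q2)"
    by (rule risk_midpoint_less[OF minimizer_risk_finite[OF h Q(1)] minimizer_risk_finite[OF h Q(2)] y ne R(2)])
  then show False using Q R(1) unfolding minimizer_def by (fastforce simp: max_def split: if_splits)
qed

text \<open>The masses of a minimizer form a boundary point of the convex hull of the Poisson curve.
  A supporting hyperplane there has nonnegative normal \<open>w\<close>, and every mixing law with the same
  masses lives on the maximizers of the corresponding combination of Poisson masses.\<close>

lemma minimizer_carrier:
  assumes h: "0 < h" and Q: "minimizer {0..h} Q"
  obtains Z where "finite Z" "card Z \<le> card Y" "Z \<subseteq> {0..h}" "0 \<in> Z \<Longrightarrow> 0 \<in> Y"
    "\<forall>R\<in>prob_measures_on {0..h}. (\<forall>y\<in>Y. mass R y = mass Q y) \<longrightarrow> R \<in> prob_measures_on Z"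
proof -
  let ?P = "prob_measures_on {0..h}"
  have QP: "Q \<in> ?P" using Q by (simp add: minimizer_def)
  \<comment> \<open>Mass vectors are taken relative to \<open>Q\<close>: an element of
    \<open>K\<close> positive on all of \<open>Y\<close> would be a strictly better law, so
    \<open>K\<close> misses the open positive orthant.\<close>
  define K where "K = (\<lambda>R y. mass R y - mass Q y) ` ?P"
  have "\<exists>w. (\<forall>y\<in>Y. 0 \<le> w y) \<and> (\<exists>y\<in>Y. 0 < w y) \<and> (\<forall>v\<in>K. (\<Sum>y\<in>Y. w y * v y) \<le> 0)"
  proof (rule separating_weights[OF finite_support set_pmf_not_empty])
    fix u v and t :: real assume *: "u \<in> K" "v \<in> K" "0 \<le> t" "t \<le> 1"
    then obtain R S where RS: "R \<in> ?P" "u = (\<lambda>y. mass R y - mass Q y)"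
      "S \<in> ?P" "v = (\<lambda>y. mass S y - mass Q y)" by (auto simp: K_def)
    obtain T where T: "T \<in> ?P" "\<And>y. mass T y = t * mass R y + (1 - t) * mass S y"
      by (rule convex_combination_mass[OF RS(1,3) _ *(3,4)]) (simp, rule that)
    have "(\<lambda>y. t * u y + (1 - t) * v y) = (\<lambda>y. mass T y - mass Q y)"
      by (simp add: RS T fun_eq_iff algebra_simps)
    then show "(\<lambda>y. t * u y + (1 - t) * v y) \<in> K"
      unfolding K_def using T(1) by (rule image_eqI)
  next
    fix v assume "v \<in> K"
    then obtain R where R: "R \<in> ?P" "v = (\<lambda>y. mass R y - mass Q y)" by (auto simp: K_def)
    show "\<exists>y\<in>Y. v y \<le> 0"
    proof (rule ccontr)
      assume "\<not> ?thesis"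
      then have "risk R < risk Q" using R by (intro risk_less) (auto simp: not_le)
      then show False using Q R by (auto simp: minimizer_def)
    qed
  qed
  then obtain w where w: "\<And>y. y \<in> Y \<Longrightarrow> 0 \<le> w y" "\<exists>y\<in>Y. 0 < w y"
    and sep: "\<And>R. R \<in> ?P \<Longrightarrow> (\<Sum>y\<in>Y. w y * (mass R y - mass Q y)) \<le> 0"
    by (auto simp: K_def)
  define M where "M = (\<Sum>y\<in>Y. w y * mass Q y)"
  define g where "g \<theta> = (\<Sum>y\<in>Y. w y * poisson_mass \<theta> y)" for \<theta>
  have gle: "g \<theta> \<le> M" if "0 \<le> \<theta>" "\<theta> \<le> h" for \<theta>
    using sep[OF return_in_prob_measures_on, of \<theta>] that
    by (simp add: mass_return g_def M_def right_diff_distrib sum_subtractf)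
  obtain y1 where "y1 \<in> Y" "0 < w y1" using w by blast
  then have "0 < g h" unfolding g_def
    using w h finite_support
    by (intro sum_pos2[of _ y1]) (auto intro!: mult_pos_pos mult_nonneg_nonneg
        simp: poisson_mass_pos less_imp_le)
  then have M: "0 < M" using gle[of h] h by simp
  define Z where "Z = {\<theta>\<in>{0..h}. g \<theta> = M}"
  have "(\<Sum>y\<in>Y. w y * poisson_mass \<theta> y) \<le> M" if "0 \<le> \<theta>" "\<theta> \<le> h" for \<theta>
    using gle[OF that] by (simp add: g_def)
  from poisson_combination_argmax[OF finite_support M this, of h]
  have Z: "finite Z" "card Z \<le> card Y" "0 \<in> Z \<Longrightarrow> 0 \<in> Y"
    by (simp_all add: Z_def g_def)
  have carrier: "R \<in> prob_measures_on Z"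
    if R: "R \<in> ?P" "\<forall>y\<in>Y. mass R y = mass Q y" for R
  proof -
    interpret real_distribution R using prob_measures_onD[OF R(1)] by simp
    \<comment> \<open>This function is nonnegative on \<open>{0..h}\<close> and has integral 0 under
      \<open>R\<close>, so it vanishes almost everywhere.\<close>
    let ?f = "\<lambda>\<theta>. M - (\<Sum>y\<in>Y. w y * clipped_mass y \<theta>)"
    have f: "?f \<theta> = M - g \<theta>" if "\<theta> \<in> {0..h}" for \<theta>
      using that by (simp add: g_def clipped_mass_def)
    note int = integrable_clipped_mass[OF R(1)]
    have "(\<integral>\<theta>. ?f \<theta> \<partial>R) = M - (\<Sum>y\<in>Y. w y * mass R y)"
      by (simp add: int mass_def prob_space[unfolded space_eq_univ])
    also have "\<dots> = 0" using R(2) by (simp add: M_def)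
    finally have int_0: "(\<integral>\<theta>. ?f \<theta> \<partial>R) = 0" .
    have int_f: "integrable R ?f"
      by (intro Bochner_Integration.integrable_diff Bochner_Integration.integrable_sum
        integrable_mult_right int integrable_const)
    have "AE \<theta> in R. 0 \<le> ?f \<theta>"
      using prob_measures_on_AE[OF R(1)] by eventually_elim (use f gle in auto)
    then have "AE \<theta> in R. ?f \<theta> = 0"
      using integral_nonneg_eq_0_iff_AE[OF int_f] int_0 by simp
    then have "AE \<theta> in R. \<theta> \<in> Z"
      using prob_measures_on_AE[OF R(1)] by eventually_elim (use f in \<open>auto simp: Z_def\<close>)
    then show ?thesis
      using prob_space_axioms Z(1) by (intro prob_measures_onI) (auto intro: borel_closed finite_imp_closed)
  qed
  show thesis
  proof (rule that)
    show "Z \<subseteq> {0..h}" by (auto simp: Z_def)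
    show "\<forall>R\<in>?P. (\<forall>y\<in>Y. mass R y = mass Q y) \<longrightarrow> R \<in> prob_measures_on Z"
      using carrier by simp
  qed (fact Z)+
qed

text \<open>Both minimizers share their masses on \<open>Y\<close> and hence the finite carrier
  \<open>Z\<close>; the differences of their atoms solve a homogeneous linear system with trivial
  kernel.\<close>

lemma minimizer_unique:
  assumes h: "0 < h" and Q: "minimizer {0..h} Q1" "minimizer {0..h} Q2"
  shows "Q1 = Q2"
proof -
  obtain Z where Z: "finite Z" "card Z \<le> card Y" "Z \<subseteq> {0..h}" "0 \<in> Z \<Longrightarrow> 0 \<in> Y"
    and carrier: "\<forall>R\<in>prob_measures_on {0..h}. (\<forall>y\<in>Y. mass R y = mass Q1 y) \<longrightarrow>
      R \<in> prob_measures_on Z"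
    by (rule minimizer_carrier[OF h Q(1)]) (rule that)
  note eq = minimizers_mass_eq[OF h Q(2,1)]
  have QZ: "Q1 \<in> prob_measures_on Z" "Q2 \<in> prob_measures_on Z"
    using Q eq carrier by (simp_all add: minimizer_def)
  have mass: "mass R y = (\<Sum>z\<in>Z. measure R {z} * poisson_mass z y)"
    if "R \<in> prob_measures_on Z" for R y
    unfolding mass_def using Z(3)
    by (subst integral_eq_sum_atoms[OF that Z(1)])
      (auto intro!: sum.cong simp: clipped_mass_def subset_iff max_absorb2)
  have "\<forall>z\<in>Z. measure Q1 {z} - measure Q2 {z} = 0"
  proof (rule poisson_mass_linear_independent[OF finite_support Z(1) _ Z(2,4)])
    show "Z \<subseteq> {0..}" using Z by auto
    show "(\<Sum>z\<in>Z. (measure Q1 {z} - measure Q2 {z}) * poisson_mass z y) = 0" if "y \<in> Y" for y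
      using eq[OF that] unfolding mass[OF QZ(1)] mass[OF QZ(2)]
      by (simp add: left_diff_distrib sum_subtractf)
  qed
  then show ?thesis by (intro atomic_measures_eqI[OF QZ Z(1)]) simp
qed

lemma minimizer_discrete:
  assumes h: "0 < h" and Q: "minimizer {0..h} Q"
  shows "discrete_distribution Q" "finite (measure_support Q)" "card (measure_support Q) \<le> card Y"
proof -
  obtain Z where Z: "finite Z" "card Z \<le> card Y" "Z \<subseteq> {0..h}" "0 \<in> Z \<Longrightarrow> 0 \<in> Y"
    and carrier: "\<forall>R\<in>prob_measures_on {0..h}. (\<forall>y\<in>Y. mass R y = mass Q y) \<longrightarrow>
      R \<in> prob_measures_on Z"
    by (rule minimizer_carrier[OF h Q]) (rule that)
  have QZ: "Q \<in> prob_measures_on Z"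
    using Q carrier by (simp add: minimizer_def)
  have "countable Z" using Z(1) by (rule countable_finite)
  then show "discrete_distribution Q"
    using prob_measures_onD(2)[OF QZ] unfolding discrete_distribution_def by blast
  have sub: "measure_support Q \<subseteq> Z"
    by (rule measure_support_subset[OF QZ finite_imp_closed[OF Z(1)]])
  then show "finite (measure_support Q)" using Z(1) by (rule finite_subset)
  show "card (measure_support Q) \<le> card Y"
    using card_mono[OF Z(1) sub] Z(2) by simp
qed

section \<open>Reduction of the half-line to a bounded interval\<close>

lemma support_bounds: "y \<in> Y \<Longrightarrow> real (Min Y) \<le> real y" "y \<in> Y \<Longrightarrow> real y \<le> real (Max Y)"
  using finite_support by simp_all

text \<open>Otherwise clamping would strictly raise every mass on \<open>Y\<close> and so lower the
  risk.\<close>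

lemma half_line_minimizer:
  assumes Q: "minimizer {0..} Q"
  shows "Q \<in> prob_measures_on {real (Min Y)..real (Max Y)}"
proof (rule ccontr)
  assume notin: "Q \<notin> prob_measures_on {real (Min Y)..real (Max Y)}"
  have QP: "Q \<in> prob_measures_on {0..}" using Q by (simp add: minimizer_def)
  have "real (Min Y) \<le> real (Max Y)"
    using finite_support set_pmf_not_empty[of p] by (simp add: Min_le)
  then obtain R where R: "R \<in> prob_measures_on {real (Min Y)..real (Max Y)}"
    and "\<And>y. \<lbrakk>real (Min Y) \<le> real y; real y \<le> real (Max Y);
      Q \<notin> prob_measures_on {real (Min Y)..real (Max Y)}\<rbrakk> \<Longrightarrow> mass Q y < mass R y"
    by (rule clamp_measure[OF QP of_nat_0_le_iff, folded mass_def]) (rule that)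
  then have less: "mass Q y < mass R y" if "y \<in> Y" for y
    using support_bounds[OF that] notin by blast
  have "R \<in> prob_measures_on {0..}" using R by (rule prob_measures_on_mono) auto
  then show False using Q risk_less[OF less] by (auto simp: minimizer_def)
qed

text \<open>Transfers existence and uniqueness to the half-line: clamping any law to
  \<open>{0..h}\<close> does not increase its risk, since all of \<open>Y\<close> lies in the
  interval.\<close>

lemma half_line_minimizer_iff:
  assumes h: "real (Max Y) \<le> h"
  shows "minimizer {0..} Q \<longleftrightarrow> minimizer {0..h} Q"
proof
  assume Q: "minimizer {0..} Q"
  have "Q \<in> prob_measures_on {0..h}"
    using half_line_minimizer[OF Q] by (rule prob_measures_on_mono) (use h in auto)
  moreover have "R \<in> prob_measures_on {0..}" if "R \<in> prob_measures_on {0..h}" for R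
    using that by (rule prob_measures_on_mono) auto
  ultimately show "minimizer {0..h} Q" using Q by (auto simp: minimizer_def)
next
  assume Q: "minimizer {0..h} Q"
  have "Q \<in> prob_measures_on {0..}"
    using Q unfolding minimizer_def by (auto intro: prob_measures_on_mono)
  moreover have "risk Q \<le> risk R" if R: "R \<in> prob_measures_on {0..}" for R
  proof -
    have "0 \<le> h" using h by (rule order_trans[rotated]) simp
    then obtain S where S: "S \<in> prob_measures_on {0..h}"
      and "\<And>y. \<lbrakk>0 \<le> real y; real y \<le> h\<rbrakk> \<Longrightarrow> mass R y \<le> mass S y"
      by (rule clamp_measure[OF R order_refl, folded mass_def]) (rule that)
    then have le: "mass R y \<le> mass S y" if "y \<in> Y" for y
      using support_bounds(2)[OF that] h by simp
    have "risk Q \<le> risk S" using Q S by (simp add: minimizer_def)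
    also have "\<dots> \<le> risk R" by (intro risk_antimono le)
    finally show ?thesis .
  qed
  ultimately show "minimizer {0..} Q" by (simp add: minimizer_def)
qed

end

section \<open>From the distance to the risk\<close>

lemma decomposition_minimizer_iff:
  assumes "decomposition_property D" "finite (set_pmf p)"
  shows "\<exists>L. decomposed_risk L p \<and>
    (\<forall>\<Theta> Q. \<Theta> \<subseteq> {0..} \<longrightarrow> is_mixing_minimizer D p \<Theta> Q = decomposed_risk.minimizer L p \<Theta> Q)"
proof -
  obtain t L where L: "admissible_loss L"
    and D: "\<And>q1 q2. D q1 q2 = ereal (t q1) + (\<Sum>y. L (pmf q1 y) (pmf q2 y))"
    using assms(1) by (auto simp: decomposition_property_def)
  interpret decomposed_risk L p using L assms(2) by unfold_locales
  have D_eq: "D p (poisson_mixture Q) = ereal (t p) + risk Q"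
    if "Q \<in> prob_measures_on \<Theta>" "\<Theta> \<subseteq> {0..}" for Q \<Theta>
  proof -
    have "(\<Sum>y. L (pmf p y) (pmf (poisson_mixture Q) y))
        = (\<Sum>y\<in>Y. L (pmf p y) (pmf (poisson_mixture Q) y))"
      using finite_support L by (intro suminf_finite) (auto simp: set_pmf_iff admissible_loss_def)
    then show ?thesis
      by (simp add: D risk_def mass_def pmf_poisson_mixture_clipped[OF that])
  qed
  \<comment> \<open>The additive constant \<open>t p\<close> is finite, so it does not affect
    comparisons, even with infinite values.\<close>
  have cancel: "ereal c + a < ereal c + b \<longleftrightarrow> a < b" for c a b
    by (cases a; cases b) simp_all
  have "is_mixing_minimizer D p \<Theta> Q \<longleftrightarrow> minimizer \<Theta> Q" if "\<Theta> \<subseteq> {0..}" for \<Theta> Q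
  proof -
    have "D p (poisson_mixture R) < D p (poisson_mixture Q) \<longleftrightarrow> risk R < risk Q"
      if "R \<in> prob_measures_on \<Theta>" "Q \<in> prob_measures_on \<Theta>" for R
      using that \<open>\<Theta> \<subseteq> {0..}\<close> by (simp add: D_eq cancel)
    then show ?thesis
      unfolding is_mixing_minimizer_def is_arg_min_def minimizer_def not_less[symmetric] by blast
  qed
  then show ?thesis using decomposed_risk_axioms by blast
qed

theorem theorem1:
  fixes D :: "nat pmf \<Rightarrow> nat pmf \<Rightarrow> ereal" and p :: "nat pmf" and m :: nat
  assumes "generalized_distance D"
    and "decomposition_property D"
    and "finite (set_pmf p)"
    and "card (set_pmf p) = m"
  shows "(\<forall>h>0.
            (\<exists>!Q. is_mixing_minimizer D p {0..h} Q) \<and>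
            (\<forall>Q. is_mixing_minimizer D p {0..h} Q \<longrightarrow>
               discrete_distribution Q \<and>
               finite (measure_support Q) \<and> card (measure_support Q) \<le> m)) \<and>
         (\<exists>!Q. is_mixing_minimizer D p {0..} Q) \<and>
         (\<forall>Q. is_mixing_minimizer D p {0..} Q \<longrightarrow>
            discrete_distribution Q \<and>
            finite (measure_support Q) \<and> card (measure_support Q) \<le> m \<and>
            measure_support Q \<subseteq> {real (Min (set_pmf p))..real (Max (set_pmf p))})"
proof -
  obtain L where L: "decomposed_risk L p"
    and iff: "\<forall>\<Theta> Q. \<Theta> \<subseteq> {0..} \<longrightarrow>
      is_mixing_minimizer D p \<Theta> Q = decomposed_risk.minimizer L p \<Theta> Q"
    using decomposition_minimizer_iff[OF assms(2,3)] by blast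
  interpret decomposed_risk L p by (rule L)
  have minimizer_eq: "is_mixing_minimizer D p {0..h} = minimizer {0..h}"
    "is_mixing_minimizer D p {0..} = minimizer {0..}" for h
    using iff by (auto simp: fun_eq_iff)
  have interval: "(\<exists>!Q. minimizer {0..h} Q) \<and> (\<forall>Q. minimizer {0..h} Q \<longrightarrow>
      discrete_distribution Q \<and> finite (measure_support Q) \<and> card (measure_support Q) \<le> m)"
    if "0 < h" for h
    using minimizer_exists[OF that] minimizer_unique[OF that] minimizer_discrete[OF that] assms(4)
    by blast
  \<comment> \<open>The summand 1 keeps the right endpoint positive when \<open>p\<close> is the
    point mass at 0.\<close>
  have half_line: "minimizer {0..} Q \<longleftrightarrow> minimizer {0..real (Max Y) + 1} Q" for Q
    by (rule half_line_minimizer_iff) simp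
  have bounds: "measure_support Q \<subseteq> {real (Min Y)..real (Max Y)}" if "minimizer {0..} Q" for Q
    using half_line_minimizer[OF that] by (rule measure_support_subset) simp
  have "0 < real (Max Y) + 1" by simp
  note max = interval[OF this, folded half_line]
  show ?thesis unfolding minimizer_eq using interval max bounds by blast
qed

end
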